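(* Let $D=(d_1,\ldots,d_n)$ be a non-principal polarisation type, i.e. positive integers with $d_1=1$, $d_i\mid d_{i+1}$ for $i=1,\ldots,n-1$, and $D\neq(1,\ldots,1)$. Let $A$ be a very general $D$-polarised complex abelian variety. Then $A$ is not isomorphic to its dual $\hat{A}$.
   Context: All abelian varieties are over $\mathbb{C}$. A polarisation on an abelian variety $A$ is the Néron–Severi class of an ample line bundle $\mathcal{L}$; with $\varphi_{\mathcal{L}}:A\to\hat A=\mathrm{Pic}^0(A)$, $x\mapsto t_x^*\mathcal{L}\otimes\mathcal{L}^{-1}$ ($t_x$ translation by $x$), one has $\ker\varphi_{\mathcal{L}}\cong(\mathbb{Z}_{d_1}\times\cdots\times\mathbb{Z}_{d_n})^2$ with $d_i\mid d_{i+1}$, and $(d_1,\ldots,d_n)$ is called the type. A $D$-polarised abelian variety is an abelian variety with a polarisation of type $D$; principal means type $(1,\ldots,1)$. "Very general" means: an element of the moduli space of $D$-polarised abelian varieties of dimension $n$ lying outside countably many subloci of smaller dimension (the assertion is that such a countable collection of subloci exists so that the conclusion holds for every $A$ outside them). In particular, a very general $A$ is assumed to satisfy $NS(A)\cong\mathbb{Z}$ and $\mathrm{End}(A)=\mathbb{Z}$. "Isomorphic" means abstractly isomorphic as abelian varieties, with no compatibility with polarisations required. *)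

theory Defs
  imports "HOL-Analysis.Analysis" "HOL-Algebra.Product_Groups"
begin

section \<open>Holomorphic functions on C^n and on spaces of complex matrices\<close>

text \<open>\<open>smul\<close> is the multiplication by complex scalars on the real vector space \<open>'a\<close>;
  the derivative has to be linear with respect to it. Used for open \<open>U\<close> only.\<close>

definition holomorphic_wrt ::
    "(complex \<Rightarrow> 'a \<Rightarrow> 'a) \<Rightarrow> ('a::euclidean_space \<Rightarrow> complex) \<Rightarrow> 'a set \<Rightarrow> bool" where
  "holomorphic_wrt smul f U \<longleftrightarrow>
     (\<forall>x\<in>U. \<exists>f'. (f has_derivative f') (at x) \<and> (\<forall>c u. f' (smul c u) = c * f' u))"

definition entire :: "(complex^'n \<Rightarrow> complex) \<Rightarrow> bool" where
  "entire f \<longleftrightarrow> holomorphic_wrt (*s) f UNIV"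

definition entire_map :: "(complex^'n \<Rightarrow> complex^'m) \<Rightarrow> bool" where
  "entire_map F \<longleftrightarrow> (\<forall>i. entire (\<lambda>v. F v $ i))"

definition mat_scale :: "complex \<Rightarrow> complex^'n^'m \<Rightarrow> complex^'n^'m" where
  "mat_scale c M = (\<chi> i j. c * M $ i $ j)"

section \<open>Complex tori\<close>

text \<open>A complex torus is V / L with V = C^n and L a lattice; it is represented by L.\<close>

definition lattice_in :: "(complex^'n) set \<Rightarrow> bool" where
  "lattice_in L \<longleftrightarrow>
     (\<exists>B. independent B \<and> span B = UNIV \<and> L = {\<Sum>b\<in>B. of_int (k b) *\<^sub>R b | k :: complex^'n \<Rightarrow> int. True})"

text \<open>As V is simply connected, the holomorphic maps V / L \<open>\<rightarrow>\<close> V' / L' are exactly those induced by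
  holomorphic maps F : V \<open>\<rightarrow>\<close> V' that respect the lattices. Maps of tori are represented by such
  lifts; two lifts represent the same map iff they agree modulo L'.\<close>

definition torus_hom ::
    "(complex^'n) set \<Rightarrow> (complex^'m) set \<Rightarrow> (complex^'n \<Rightarrow> complex^'m) \<Rightarrow> bool" where
  "torus_hom L L' F \<longleftrightarrow>
     entire_map F \<and>
     (\<forall>v. \<forall>l\<in>L. F (v + l) - F v \<in> L') \<and>
     (\<forall>v w. F (v + w) - (F v + F w) \<in> L')"

definition torus_iso ::
    "(complex^'n) set \<Rightarrow> (complex^'m) set \<Rightarrow> (complex^'n \<Rightarrow> complex^'m) \<Rightarrow> bool" where
  "torus_iso L L' F \<longleftrightarrow>
     torus_hom L L' F \<and>
     (\<exists>G. torus_hom L' L G \<and> (\<forall>v. G (F v) - v \<in> L) \<and> (\<forall>w. F (G w) - w \<in> L'))"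

section \<open>Line bundles\<close>

text \<open>Every holomorphic line bundle on V becomes trivial, so line bundles on V / L are quotients of
  V \<open>\<times>\<close> C by an action l . (v, t) = (v + l, e l v * t) of L, that is, factors of automorphy e.
  Only the values e l v with l in L matter. Isomorphisms of line bundles are induced by
  automorphisms (v, t) \<open>\<mapsto>\<close> (v, h v * t) of V \<open>\<times>\<close> C.\<close>

type_synonym 'n factor = "complex^'n \<Rightarrow> complex^'n \<Rightarrow> complex"

definition line_bundle :: "(complex^'n) set \<Rightarrow> 'n factor \<Rightarrow> bool" where
  "line_bundle L e \<longleftrightarrow>
     (\<forall>l\<in>L. entire (e l) \<and> (\<forall>v. e l v \<noteq> 0)) \<and>
     (\<forall>l\<in>L. \<forall>m\<in>L. \<forall>v. e (l + m) v = e l (v + m) * e m v)"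

definition bundle_iso :: "(complex^'n) set \<Rightarrow> 'n factor \<Rightarrow> 'n factor \<Rightarrow> bool" where
  "bundle_iso L e e' \<longleftrightarrow>
     (\<exists>h. entire h \<and> (\<forall>v. h v \<noteq> 0) \<and> (\<forall>l\<in>L. \<forall>v. e' l v * h v = h (v + l) * e l v))"

definition trivial_bundle :: "'n factor" where
  "trivial_bundle = (\<lambda>l v. 1)"

definition tensor :: "'n factor \<Rightarrow> 'n factor \<Rightarrow> 'n factor" where
  "tensor e e' = (\<lambda>l v. e l v * e' l v)"

definition dual_bundle :: "'n factor \<Rightarrow> 'n factor" where
  "dual_bundle e = (\<lambda>l v. inverse (e l v))"

definition tensor_power :: "'n factor \<Rightarrow> nat \<Rightarrow> 'n factor" where
  "tensor_power e k = (\<lambda>l v. e l v ^ k)"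

definition translate :: "complex^'n \<Rightarrow> 'n factor \<Rightarrow> 'n factor" where
  "translate x e = (\<lambda>l v. e l (v + x))"

text \<open>Pullback along the map of tori with lift F. (The period F (v + l) - F v of F
  does not depend on v.)\<close>

definition pullback :: "(complex^'n \<Rightarrow> complex^'m) \<Rightarrow> 'm factor \<Rightarrow> 'n factor" where
  "pullback F e = (\<lambda>l v. e (F (v + l) - F v) (F v))"

text \<open>Line bundles \<open>\<L>\<close> with \<open>t\<^sub>x\<^sup>* \<L> \<cong> \<L>\<close> for all x (Mumford's definition of \<open>Pic\<^sup>0\<close>).\<close>

definition Pic0 :: "(complex^'n) set \<Rightarrow> 'n factor set" where
  "Pic0 L = {e. line_bundle L e \<and> (\<forall>x. bundle_iso L (translate x e) e)}"

definition NS_equiv :: "(complex^'n) set \<Rightarrow> 'n factor \<Rightarrow> 'n factor \<Rightarrow> bool" where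
  "NS_equiv L e e' \<longleftrightarrow> tensor e (dual_bundle e') \<in> Pic0 L"

definition global_section :: "(complex^'n) set \<Rightarrow> 'n factor \<Rightarrow> (complex^'n \<Rightarrow> complex) \<Rightarrow> bool" where
  "global_section L e s \<longleftrightarrow> entire s \<and> (\<forall>l\<in>L. \<forall>v. s (v + l) = e l v * s v)"

text \<open>The sections define a closed embedding of the compact manifold V / L into projective space:
  they have no common zero, separate points, and separate tangent vectors.\<close>

definition very_ample :: "(complex^'n) set \<Rightarrow> 'n factor \<Rightarrow> bool" where
  "very_ample L e \<longleftrightarrow>
     (\<forall>v. \<exists>s. global_section L e s \<and> s v \<noteq> 0) \<and>
     (\<forall>v w. v - w \<notin> L \<longrightarrow> (\<exists>s. global_section L e s \<and> s v = 0 \<and> s w \<noteq> 0)) \<and>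
     (\<forall>v u. u \<noteq> 0 \<longrightarrow> (\<exists>s. global_section L e s \<and> s v = 0 \<and> frechet_derivative s (at v) u \<noteq> 0))"

definition ample :: "(complex^'n) set \<Rightarrow> 'n factor \<Rightarrow> bool" where
  "ample L e \<longleftrightarrow> (\<exists>k\<ge>1. very_ample L (tensor_power e k))"

section \<open>Polarised abelian varieties and their types\<close>

definition phi :: "'n factor \<Rightarrow> complex^'n \<Rightarrow> 'n factor" where
  "phi e x = tensor (translate x e) (dual_bundle e)"

definition ker_phi :: "(complex^'n) set \<Rightarrow> 'n factor \<Rightarrow> (complex^'n) set monoid" where
  "ker_phi L e =
     \<lparr>carrier = {x. bundle_iso L (phi e x) trivial_bundle}, monoid.mult = (+), one = 0\<rparr> Mod L"

definition has_type :: "(complex^'n) set \<Rightarrow> 'n factor \<Rightarrow> ('n::finite \<Rightarrow> nat) \<Rightarrow> bool" where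
  "has_type L e d \<longleftrightarrow>
     ker_phi L e \<cong> product_group UNIV (\<lambda>i. integer_mod_group (d i))
                     \<times>\<times> product_group UNIV (\<lambda>i. integer_mod_group (d i))"

text \<open>A polarisation is a Neron-Severi class; it is represented by an ample line bundle in it.\<close>

type_synonym 'n polarised = "(complex^'n) set \<times> 'n factor"

definition polarised_AVs :: "('n::finite \<Rightarrow> nat) \<Rightarrow> 'n polarised set" where
  "polarised_AVs d = {(L, e). lattice_in L \<and> line_bundle L e \<and> ample L e \<and> has_type L e d}"

definition polarised_iso :: "('n::finite) polarised \<Rightarrow> 'n polarised \<Rightarrow> bool" where
  "polarised_iso A B \<longleftrightarrow>
     (\<exists>F. torus_iso (fst A) (fst B) F \<and> NS_equiv (fst A) (pullback F (snd B)) (snd A))"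

section \<open>The dual abelian variety\<close>

text \<open>The dual of A = V / L is the group \<open>Pic\<^sup>0(A)\<close> of isomorphism classes of line bundles. Its complex
  structure is the one for which the homomorphism from the space of antilinear forms on V to
  \<open>Pic\<^sup>0(A)\<close>, which sends a form a to the flat line bundle with character l \<open>\<mapsto>\<close> exp (2 pi i Im (a l)),
  is a holomorphic covering. A vector w of C^n stands for the form a v = \<open>\<Sum>\<close>i. w i * cnj (v i).\<close>

definition flat_bundle :: "complex^'n \<Rightarrow> 'n factor" where
  "flat_bundle w = (\<lambda>l v. exp (2 * of_real pi * \<i> * of_real (Im (\<Sum>i\<in>UNIV. w $ i * cnj (l $ i)))))"

text \<open>A holomorphic map from A to \<open>Pic\<^sup>0(A)\<close> lifts to a holomorphic F from V to the space of antilinear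
  forms; the map is x \<open>\<mapsto>\<close> flat_bundle (F x). The conditions say that it is a
  homomorphism, that its kernel is 0 (so that it is well defined on V / L and injective), that it is
  onto \<open>Pic\<^sup>0(A)\<close>, and that the inverse map, lifted to G, is holomorphic.\<close>

definition isomorphic_to_dual :: "(complex^'n) set \<Rightarrow> bool" where
  "isomorphic_to_dual L \<longleftrightarrow>
     (\<exists>F. entire_map F \<and>
          (\<forall>x. flat_bundle (F x) \<in> Pic0 L) \<and>
          (\<forall>x y. bundle_iso L (flat_bundle (F (x + y))) (tensor (flat_bundle (F x)) (flat_bundle (F y)))) \<and>
          (\<forall>x. bundle_iso L (flat_bundle (F x)) trivial_bundle \<longleftrightarrow> x \<in> L) \<and>
          (\<forall>e\<in>Pic0 L. \<exists>x. bundle_iso L (flat_bundle (F x)) e) \<and>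
          (\<exists>G. entire_map G \<and> (\<forall>w. bundle_iso L (flat_bundle (F (G w))) (flat_bundle w))))"

section \<open>The moduli space of polarised abelian varieties and very general elements\<close>

definition Im_mat :: "complex^'n^'m \<Rightarrow> real^'n^'m" where
  "Im_mat \<tau> = (\<chi> i j. Im (\<tau> $ i $ j))"

definition Siegel :: "(complex^'n^'n) set" where
  "Siegel = {\<tau>. transpose \<tau> = \<tau> \<and> (\<forall>x::real^'n. x \<noteq> 0 \<longrightarrow> x \<bullet> (Im_mat \<tau> *v x) > 0)}"

text \<open>The universal family: \<open>\<tau>\<close> goes to C^n / (\<open>\<tau>\<close> Z^n + D Z^n), D = diag d, polarised by the line
  bundle whose sections satisfy
  \<open>\<theta>\<close> (v + \<open>\<tau>\<close> p + D q) = exp (- pi i p^t \<open>\<tau>\<close> p - 2 pi i p^t v) * \<open>\<theta>\<close> v  (p, q in Z^n).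
  For l = \<open>\<tau>\<close> p + D q one has Im l = (Im \<open>\<tau>\<close>) p, which recovers p from l.\<close>

definition Siegel_lattice :: "('n::finite \<Rightarrow> nat) \<Rightarrow> complex^'n^'n \<Rightarrow> (complex^'n) set" where
  "Siegel_lattice d \<tau> =
     {\<tau> *v (\<chi> i. of_int (p i)) + (\<chi> i. of_nat (d i) * of_int (q i)) | p q :: 'n \<Rightarrow> int. True}"

definition Siegel_bundle :: "complex^'n^'n \<Rightarrow> 'n factor" where
  "Siegel_bundle \<tau> = (\<lambda>l v.
     let r = matrix_inv (Im_mat \<tau>) *v (\<chi> i. Im (l $ i)); p = (\<chi> i. complex_of_real (r $ i))
     in exp (- of_real pi * \<i> * (\<Sum>i\<in>UNIV. p $ i * (\<tau> *v p) $ i)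
             - 2 * of_real pi * \<i> * (\<Sum>i\<in>UNIV. p $ i * v $ i)))"

definition Siegel_AV :: "('n::finite \<Rightarrow> nat) \<Rightarrow> complex^'n^'n \<Rightarrow> 'n polarised" where
  "Siegel_AV d \<tau> = (Siegel_lattice d \<tau>, Siegel_bundle \<tau>)"

text \<open>Closed analytic subsets of \<open>Siegel\<close>. A function on \<open>Siegel\<close>, which is open in the space of
  symmetric matrices, is holomorphic iff locally it extends holomorphically to all matrices.\<close>

definition analytic_subset :: "(complex^'n^'n) set \<Rightarrow> bool" where
  "analytic_subset W \<longleftrightarrow>
     W \<subseteq> Siegel \<and>
     (\<forall>\<tau>\<in>Siegel. \<exists>\<epsilon>>0. \<exists>S. finite S \<and> (\<forall>f\<in>S. holomorphic_wrt mat_scale f (ball \<tau> \<epsilon>)) \<and>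
        W \<inter> ball \<tau> \<epsilon> = {\<sigma>\<in>Siegel \<inter> ball \<tau> \<epsilon>. \<forall>f\<in>S. f \<sigma> = 0})"

text \<open>The moduli space of d-polarised abelian varieties is the set of isomorphism classes of
  \<open>polarised_AVs d\<close>, with the quotient analytic structure from the surjection
  \<open>\<tau>\<close> \<open>\<mapsto>\<close> \<open>Siegel_AV d \<tau>\<close>. A subset of it is given by an isomorphism-invariant set Z; it is
  analytic iff its preimage in \<open>Siegel\<close> is, and then it has smaller dimension than the
  moduli space iff the preimage has dense complement.\<close>

definition smaller_sublocus :: "('n::finite \<Rightarrow> nat) \<Rightarrow> 'n polarised set \<Rightarrow> bool" where
  "smaller_sublocus d Z \<longleftrightarrow>
     (\<forall>A\<in>polarised_AVs d. \<forall>B\<in>polarised_AVs d. polarised_iso A B \<longrightarrow> (A \<in> Z \<longleftrightarrow> B \<in> Z)) \<and>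
     (let W = {\<tau>\<in>Siegel. Siegel_AV d \<tau> \<in> Z} in analytic_subset W \<and> Siegel \<subseteq> closure (Siegel - W))"

definition very_generally :: "('n::finite \<Rightarrow> nat) \<Rightarrow> ('n polarised \<Rightarrow> bool) \<Rightarrow> bool" where
  "very_generally d P \<longleftrightarrow>
     (\<exists>\<Z>. countable \<Z> \<and> (\<forall>Z\<in>\<Z>. smaller_sublocus d Z) \<and>
          (\<forall>A\<in>polarised_AVs d. A \<notin> \<Union>\<Z> \<longrightarrow> P A))"

end

theory Submission
  imports Defs "HOL-Complex_Analysis.Cauchy_Integral_Formula"
begin

text \<open>An isomorphism from V / L to its dual amounts to a sesquilinear form on V whose imaginary part b, a real
  bilinear form with \<open>b (i x) (i y) = b x y\<close>, is unimodular on L. For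
  \<open>L = \<tau> Z\<^sup>n + D Z\<^sup>n\<close> such a b is not a multiple of the Riemann form E of the polarisation, as E takes the
  value 1 on L (because \<open>d\<^sub>1 = 1\<close>) but is not unimodular on L.

  For a fixed integral matrix N, the condition that N defines a form of type (1,1) at \<open>\<tau>\<close> is polynomial in
  \<open>\<tau>\<close> and holds for all \<open>\<tau>\<close> only if N is a multiple of E. To obtain subloci that are invariant under
  isomorphisms of polarised abelian varieties, the matrices N are grouped by the value of the trace form
  of the Rosati involution. It does not depend on the choice of a symplectic basis, and it is positive
  definite on forms of type (1,1). So for \<open>\<tau>\<close> in a compact set only finitely many N of bounded trace occur,
  and the union of their loci is analytic.\<close>

section \<open>Line bundles with unitary characters and homomorphisms of tori\<close>

text \<open>An isomorphism to the dual need not be symmetric, so b is not assumed alternating: what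
  must be excluded is all of Hom from A to its dual, rationally End(A), and not just NS(A). The
  matrices N are therefore arbitrary up to integrality, and the trace form has to be positive on all
  sesquilinear forms.

  Factors of automorphy are treated without Chern classes or the Appell-Humbert theorem. Two
  rigidity facts replace them. By Liouville, an isomorphism between bundles given by unitary
  characters is constant, which turns statements on bundles into integrality of real linear forms on
  L. A continuous map into a countable set is constant, which makes lifts of homomorphisms affine.
  From then on a polarisation is seen only through its Riemann form, and an isomorphism of tori only
  through its linear part.\<close>

definition clinear :: "(complex^'n \<Rightarrow> complex^'m) \<Rightarrow> bool" where
  "clinear f \<longleftrightarrow> linear f \<and> (\<forall>c v. f (c *s v) = c *s f v)"

lemma vsmult_add: "c *s (x + y) = c *s x + c *s (y::complex^'n)"
  by (simp add: vec_eq_iff algebra_simps)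

lemma vsmult_scaleR: "c *s (r *\<^sub>R x) = r *\<^sub>R (c *s (x::complex^'n))"
  by (simp add: vec_eq_iff)

lemma linear_vsmult_left: "linear (\<lambda>z. z *s (u::complex^'n))"
  by (rule linearI) (auto simp: vec_eq_iff algebra_simps)

lemma vsmult_i_i: "\<i> *s (\<i> *s x) = - (x::complex^'n)"
  by (simp add: vec_eq_iff flip: mult.assoc)

section \<open>Entire functions of several variables and Liouville's theorem\<close>

lemma entire_iff:
  "entire f \<longleftrightarrow> (\<forall>x. \<exists>f'. (f has_derivative f') (at x) \<and> (\<forall>c u. f' (c *s u) = c * f' u))"
  by (simp add: entire_def holomorphic_wrt_def)

lemma entire_imp_continuous: "entire f \<Longrightarrow> continuous_on UNIV f"
  unfolding entire_iff continuous_on_eq_continuous_at[OF open_UNIV]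
  using has_derivative_continuous by blast

lemma entire_const: "entire (\<lambda>v. c)"
  unfolding entire_iff by (intro allI exI[of _ "\<lambda>_. 0"]) auto

lemma entire_mult:
  assumes "entire f" "entire g"
  shows "entire (\<lambda>v. f v * g v)"
  unfolding entire_iff
proof
  fix x
  obtain f' g' where
    f: "(f has_derivative f') (at x)" "\<And>c u. f' (c *s u) = c * f' u" and
    g: "(g has_derivative g') (at x)" "\<And>c u. g' (c *s u) = c * g' u"
    using assms unfolding entire_iff by metis
  have "((\<lambda>v. f v * g v) has_derivative (\<lambda>h. f x * g' h + f' h * g x)) (at x)"
    by (intro has_derivative_mult f g)
  then show "\<exists>D. ((\<lambda>v. f v * g v) has_derivative D) (at x) \<and> (\<forall>c u. D (c *s u) = c * D u)"
    by (rule exI[of _ "\<lambda>h. f x * g' h + f' h * g x", OF conjI]) (auto simp: f g algebra_simps)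
qed

lemma entire_inverse:
  assumes "entire f" "\<And>v. f v \<noteq> 0"
  shows "entire (\<lambda>v. inverse (f v))"
  unfolding entire_iff
proof
  fix x
  obtain f' where f: "(f has_derivative f') (at x)" "\<And>c u. f' (c *s u) = c * f' u"
    using assms unfolding entire_iff by metis
  have "((\<lambda>v. inverse (f v)) has_derivative (\<lambda>h. - (inverse (f x) * f' h * inverse (f x)))) (at x)"
    by (rule Deriv.has_derivative_inverse[OF assms(2) f(1)])
  then show "\<exists>D. ((\<lambda>v. inverse (f v)) has_derivative D) (at x) \<and> (\<forall>c u. D (c *s u) = c * D u)"
    by (rule exI[of _ "\<lambda>h. - (inverse (f x) * f' h * inverse (f x))", OF conjI])
      (auto simp: f algebra_simps)
qed

lemma entire_compose_affine:
  assumes "entire f" "clinear a"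
  shows "entire (\<lambda>v. f (a v + c))"
  unfolding entire_iff
proof
  fix x
  obtain f' where f: "(f has_derivative f') (at (a x + c))" "\<And>c u. f' (c *s u) = c * f' u"
    using assms unfolding entire_iff by metis
  have "(a has_derivative a) (at x)"
    using assms by (simp add: clinear_def linear_imp_has_derivative)
  then have "((\<lambda>v. a v + c) has_derivative a) (at x)"
    by (auto intro!: derivative_eq_intros)
  from has_derivative_compose[OF this f(1)]
  show "\<exists>D. ((\<lambda>v. f (a v + c)) has_derivative D) (at x) \<and> (\<forall>c u. D (c *s u) = c * D u)"
    using assms(2) f(2) by (intro exI[of _ "\<lambda>v. f' (a v)"]) (auto simp: clinear_def)
qed

lemma entire_exp_linear:
  assumes "linear g" "\<And>c v. g (c *s v) = c * g v"
  shows "entire (\<lambda>v. exp (g v))"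
  unfolding entire_iff
proof
  fix x
  have "(g has_derivative g) (at x)"
    using assms by (simp add: linear_imp_has_derivative)
  from has_derivative_compose[OF this DERIV_exp[unfolded has_field_derivative_def]]
  have "((\<lambda>v. exp (g v)) has_derivative (\<lambda>h. g h * exp (g x))) (at x)"
    by (simp add: mult.commute)
  then show "\<exists>D. ((\<lambda>v. exp (g v)) has_derivative D) (at x) \<and> (\<forall>c u. D (c *s u) = c * D u)"
    using assms(2) by (intro exI[of _ "\<lambda>h. g h * exp (g x)"]) auto
qed

text \<open>Restriction to the complex line through 0 and v reduces this to Liouville's theorem in
  one variable.\<close>

lemma entire_bounded_constant:
  assumes "entire f" "bounded (range f)"
  shows "f v = f 0"
proof -
  let ?g = "\<lambda>z. f (z *s v)"
  have "?g holomorphic_on UNIV"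
  proof -
    have "\<exists>D. (?g has_field_derivative D) (at z)" for z
    proof -
      obtain f' where f: "(f has_derivative f') (at (z *s v))" "\<And>c u. f' (c *s u) = c * f' u"
        using assms unfolding entire_iff by metis
      have "((\<lambda>z. z *s v) has_derivative (\<lambda>z. z *s v)) (at z)"
        by (rule linear_imp_has_derivative[OF linear_vsmult_left])
      from has_derivative_compose[OF this f(1)]
      have "(?g has_derivative (\<lambda>h. f' (h *s v))) (at z)" .
      moreover have "(\<lambda>h. f' (h *s v)) = (*) (f' v)"
        by (auto simp: f mult.commute)
      ultimately show ?thesis
        unfolding has_field_derivative_def by auto
    qed
    then show ?thesis
      by (simp add: holomorphic_on_def field_differentiable_def)
  qed
  moreover have "bounded (range ?g)"
    by (rule bounded_subset[OF assms(2)]) auto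
  ultimately have "?g constant_on UNIV"
    by (rule Liouville_theorem)
  then have "?g 1 = ?g 0"
    unfolding constant_on_def by (metis UNIV_I)
  then show ?thesis by simp
qed

section \<open>Cocompactness and countability of lattices\<close>

definition cobounded :: "'a::real_normed_vector set \<Rightarrow> bool" where
  "cobounded L \<longleftrightarrow> (\<exists>r. \<forall>v. \<exists>l\<in>L. norm (v - l) \<le> r)"

text \<open>Rounding the coefficients down leaves a remainder in the parallelotope spanned by u. A
  family that spans over the reals is enough, which covers both bases of abstract lattices and
  \<open>siegel_basis\<close>.\<close>

lemma coboundedI:
  fixes u :: "'i \<Rightarrow> 'a::real_normed_vector"
  assumes "\<And>k :: 'i \<Rightarrow> int. (\<Sum>a\<in>I. of_int (k a) *\<^sub>R u a) \<in> L"
    and "\<And>v. \<exists>c. v = (\<Sum>a\<in>I. c a *\<^sub>R u a)"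
  shows "cobounded L"
  unfolding cobounded_def
proof (intro exI[of _ "\<Sum>a\<in>I. norm (u a)"] allI)
  fix v
  obtain c where c: "v = (\<Sum>a\<in>I. c a *\<^sub>R u a)" using assms(2) by blast
  have "norm (v - (\<Sum>a\<in>I. of_int \<lfloor>c a\<rfloor> *\<^sub>R u a)) = norm (\<Sum>a\<in>I. frac (c a) *\<^sub>R u a)"
    by (simp add: c frac_def sum_subtractf scaleR_diff_left)
  also have "\<dots> \<le> (\<Sum>a\<in>I. norm (u a))"
    by (intro sum_norm_le) (auto simp: frac_ge_0 intro!: mult_left_le_one_le less_imp_le[OF frac_lt_1])
  finally show "\<exists>l\<in>L. norm (v - l) \<le> (\<Sum>a\<in>I. norm (u a))"
    by (rule bexI) (rule assms(1))
qed

lemma lattice_basis: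
  assumes "lattice_in L"
  obtains B where "finite B" "independent B" "span B = UNIV"
    "L = {\<Sum>b\<in>B. of_int (k b) *\<^sub>R b | k :: complex^'n \<Rightarrow> int. True}"
  using assms unfolding lattice_in_def using finiteI_independent by blast

lemma lattice_cobounded:
  assumes "lattice_in (L :: (complex^'n) set)"
  shows "cobounded L"
proof -
  obtain B where B: "finite B" "independent B" "span B = UNIV"
    "L = {\<Sum>b\<in>B. of_int (k b) *\<^sub>R b | k :: complex^'n \<Rightarrow> int. True}"
    using lattice_basis[OF assms] .
  show ?thesis
  proof (rule coboundedI[where I = B and u = "\<lambda>x. x"])
    show "\<exists>c. v = (\<Sum>a\<in>B. c a *\<^sub>R a)" for v
    proof -
      have "v \<in> range (\<lambda>c. \<Sum>a\<in>B. c a *\<^sub>R a)" using B(3) span_finite[OF B(1)] by simp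
      then show ?thesis by blast
    qed
    show "(\<Sum>a\<in>B. of_int (k a) *\<^sub>R a) \<in> L" for k :: "complex^'n \<Rightarrow> int"
      unfolding B(4) by blast
  qed
qed

lemma lattice_countable:
  assumes "lattice_in (L :: (complex^'n) set)"
  shows "countable L"
proof -
  obtain B where B: "finite B" "independent B" "span B = UNIV"
    "L = {\<Sum>b\<in>B. of_int (k b) *\<^sub>R b | k :: complex^'n \<Rightarrow> int. True}"
    using lattice_basis[OF assms] .
  have "L \<subseteq> (\<lambda>k. \<Sum>b\<in>B. of_int (k b) *\<^sub>R b) ` (B \<rightarrow>\<^sub>E (UNIV :: int set))"
  proof
    fix x assume "x \<in> L"
    then obtain k :: "_ \<Rightarrow> int" where "x = (\<Sum>b\<in>B. of_int (k b) *\<^sub>R b)" using B(4) by auto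
    then show "x \<in> (\<lambda>k. \<Sum>b\<in>B. of_int (k b) *\<^sub>R b) ` (B \<rightarrow>\<^sub>E (UNIV :: int set))"
      by (intro image_eqI[of _ _ "restrict k B"]) auto
  qed
  moreover have "countable (B \<rightarrow>\<^sub>E (UNIV :: int set))"
    by (intro countable_PiE B) auto
  ultimately show ?thesis
    by (meson countable_image countable_subset)
qed

lemma lattice_zero: "lattice_in L \<Longrightarrow> 0 \<in> L"
  by (elim lattice_basis) (auto intro!: exI[of _ "\<lambda>_. 0"])

lemma lattice_span:
  assumes "lattice_in (L :: (complex^'n) set)"
  shows "span L = UNIV"
proof -
  obtain B where B: "finite B" "independent B" "span B = UNIV"
    "L = {\<Sum>b\<in>B. of_int (k b) *\<^sub>R b | k :: complex^'n \<Rightarrow> int. True}"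
    using lattice_basis[OF assms] .
  have "B \<subseteq> L"
  proof
    fix b assume "b \<in> B"
    then have "b = (\<Sum>x\<in>B. of_int (if x = b then 1 else 0) *\<^sub>R x)"
      using B(1) by (simp add: if_distrib[of "\<lambda>r. r *\<^sub>R _"] if_distrib[of of_int] cong: if_cong)
    then show "b \<in> L" unfolding B(4) mem_Collect_eq by (intro exI[of _ "\<lambda>x. if x = b then 1 else 0"]) auto
  qed
  then show ?thesis using B(3) span_mono by blast
qed

text \<open>Translations by L move every point into a fixed closed ball, which is compact.\<close>

lemma periodic_norm_bounded:
  fixes f :: "'a::euclidean_space \<Rightarrow> complex"
  assumes "cobounded L" "continuous_on UNIV f" "\<And>l v. l \<in> L \<Longrightarrow> norm (f (v + l)) = norm (f v)"
  shows "bounded (range f)"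
proof -
  obtain r where r: "\<And>v. \<exists>l\<in>L. norm (v - l) \<le> r" using assms(1) unfolding cobounded_def by blast
  have "compact (f ` cball 0 r)"
    by (intro compact_continuous_image continuous_on_subset[OF assms(2)]) auto
  then obtain C where C: "\<And>v. v \<in> cball 0 r \<Longrightarrow> norm (f v) \<le> C"
    by (meson bounded_iff compact_imp_bounded image_eqI)
  have "norm (f v) \<le> C" for v
  proof -
    obtain l where "l \<in> L" "norm (v - l) \<le> r" using r by blast
    then show ?thesis using C[of "v - l"] assms(3)[of l "v - l"] by simp
  qed
  then show ?thesis by (auto simp: bounded_iff)
qed

section \<open>Isomorphisms of factors of automorphy and unitary characters\<close>

lemma bundle_iso_sym:
  assumes "bundle_iso L e e'"
  shows "bundle_iso L e' e"
proof -
  obtain h where h: "entire h" "\<And>v. h v \<noteq> 0" "\<And>l v. l \<in> L \<Longrightarrow> e' l v * h v = h (v + l) * e l v"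
    using assms unfolding bundle_iso_def by blast
  show ?thesis
    unfolding bundle_iso_def using entire_inverse[OF h(1,2)] h(2,3)
    by (intro exI[of _ "\<lambda>v. inverse (h v)"]) (auto simp: field_simps)
qed

lemma bundle_iso_trans:
  assumes "bundle_iso L e e'" "bundle_iso L e' e''"
  shows "bundle_iso L e e''"
proof -
  obtain h where h: "entire h" "\<And>v. h v \<noteq> 0" "\<And>l v. l \<in> L \<Longrightarrow> e' l v * h v = h (v + l) * e l v"
    using assms unfolding bundle_iso_def by blast
  obtain k where k: "entire k" "\<And>v. k v \<noteq> 0" "\<And>l v. l \<in> L \<Longrightarrow> e'' l v * k v = k (v + l) * e' l v"
    using assms unfolding bundle_iso_def by blast
  have "e'' l v * (k v * h v) = k (v + l) * h (v + l) * e l v" if "l \<in> L" for l v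
    using h(3)[OF that, of v] k(3)[OF that, of v] by (metis mult.assoc)
  then show ?thesis
    unfolding bundle_iso_def using h k
    by (intro exI[of _ "\<lambda>v. k v * h v"]) (auto simp: entire_mult)
qed

definition character_bundle :: "(complex^'n \<Rightarrow> real) \<Rightarrow> 'n factor" where
  "character_bundle c = (\<lambda>l v. exp (2 * of_real pi * \<i> * of_real (c l)))"

lemma norm_character_bundle: "norm (character_bundle c l v) = 1"
  by (simp add: character_bundle_def norm_exp_eq_Re)

text \<open>An isomorphism \<open>h\<close> has \<open>L\<close>-periodic absolute value, so it is constant.\<close>

lemma character_bundle_iso_iff:
  fixes L :: "(complex^'n) set"
  assumes "cobounded L"
  shows "bundle_iso L (character_bundle c) (character_bundle c') \<longleftrightarrow> (\<forall>l\<in>L. c' l - c l \<in> \<int>)"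
proof
  have eq: "character_bundle c' l v = character_bundle c l v \<longleftrightarrow> c' l - c l \<in> \<int>" for l v :: "complex^'n"
  proof -
    have "character_bundle c' l v = character_bundle c l v \<longleftrightarrow>
      (\<exists>n::int. 2 * pi * c' l = 2 * pi * c l + 2 * n * pi)"
      unfolding character_bundle_def exp_eq by (simp add: complex_eq_iff)
    moreover have "2 * pi * c' l = 2 * pi * c l + 2 * n * pi \<longleftrightarrow> c' l - c l = n" for n :: int
    proof -
      have "2 * pi * c' l = 2 * pi * c l + 2 * n * pi \<longleftrightarrow> 2 * pi * (c' l - c l) = 2 * pi * n"
        by (simp add: algebra_simps)
      then show ?thesis by simp
    qed
    ultimately show ?thesis by (auto simp: Ints_def)
  qed
  show "bundle_iso L (character_bundle c) (character_bundle c')" if "\<forall>l\<in>L. c' l - c l \<in> \<int>"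
    unfolding bundle_iso_def using that
    by (intro exI[of _ "\<lambda>_. 1"]) (simp add: entire_const eq)
  assume "bundle_iso L (character_bundle c) (character_bundle c')"
  then obtain h where h: "entire h" "\<And>v. h v \<noteq> 0"
    "\<And>l v. l \<in> L \<Longrightarrow> character_bundle c' l v * h v = h (v + l) * character_bundle c l v"
    unfolding bundle_iso_def by blast
  have "norm (h (v + l)) = norm (h v)" if "l \<in> L" for l v
    using arg_cong[OF h(3)[OF that], of norm] by (simp add: norm_mult norm_character_bundle)
  then have "bounded (range h)"
    by (intro periodic_norm_bounded[OF assms] entire_imp_continuous h(1))
  then have "h v = h 0" for v
    by (rule entire_bounded_constant[OF h(1)])
  then have "character_bundle c' l 0 = character_bundle c l 0" if "l \<in> L" for l
    using h(3)[OF that, of 0] h(2)[of 0] by (metis mult.commute mult_cancel_left)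
  then show "\<forall>l\<in>L. c' l - c l \<in> \<int>" using eq by blast
qed

section \<open>Rigidity of maps that are additive modulo a countable set\<close>

lemma continuous_countable_range_constant:
  fixes f :: "'a::real_normed_vector \<Rightarrow> 'b::metric_space"
  assumes "continuous_on UNIV f" "range f \<subseteq> C" "countable C"
  shows "f x = f y"
proof -
  have "connected (range f)"
    by (intro connected_continuous_image assms) auto
  moreover have "countable (range f)"
    using assms countable_subset by blast
  ultimately show ?thesis
    using connected_uncountable by blast
qed

lemma integer_valued_linear_zero:
  fixes f :: "'a::real_vector \<Rightarrow> real"
  assumes "linear f" "\<And>x. f x \<in> \<int>"
  shows "f x = 0"
proof (rule ccontr)
  assume "f x \<noteq> 0"
  \<comment> \<open>Rescaling the argument forces the value 1/2, which is not an integer.\<close>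
  then have "f ((1 / (2 * f x)) *\<^sub>R x) = 1 / 2"
    by (simp add: linear_scale[OF assms(1)])
  then obtain k :: int where "1 / 2 = real_of_int k" using assms(2) by (metis Ints_cases)
  then have "2 * k = 1" by linarith
  then show False by presburger
qed

text \<open>The functional equation makes the derivative at every point equal to the derivative g at
  0, so f - g is constant.\<close>

lemma entire_quasi_additive:
  assumes "entire f" "\<And>x y. f (x + y) = f x + f y + c"
  obtains g where "linear g" "\<And>c v. g (c *s v) = c * g v" "\<And>v. f v = g v + f 0"
proof -
  obtain g where g: "(f has_derivative g) (at 0)" "\<And>c u. g (c *s u) = c * g u"
    using assms(1) unfolding entire_iff by metis
  have lin: "bounded_linear g" using g(1) by (rule has_derivative_bounded_linear)
  have "((\<lambda>v. f v - g v) has_derivative (\<lambda>_. 0)) (at x)" for x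
  proof -
    have "((\<lambda>v. v - x) has_derivative (\<lambda>h. h)) (at x)"
      by (auto intro!: derivative_eq_intros)
    from has_derivative_compose[OF this, of f g]
    have "((\<lambda>v. f (v - x)) has_derivative g) (at x)" using g(1) by simp
    then have "((\<lambda>v. f (v - x) + (f x + c)) has_derivative g) (at x)"
      by (auto intro!: derivative_eq_intros)
    moreover have "f (v - x) + (f x + c) = f v" for v
      using assms(2)[of "v - x" x] by simp
    ultimately have "(f has_derivative g) (at x)" by simp
    from has_derivative_diff[OF this bounded_linear_imp_has_derivative[OF lin]]
    show ?thesis by simp
  qed
  then have "f v - g v = f 0 - g 0" for v
    using has_derivative_zero_unique_connected[of UNIV "\<lambda>v. f v - g v"] by (metis UNIV_I connected_UNIV open_UNIV)
  moreover have "g 0 = 0" using lin by (simp add: linear_simps)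
  ultimately have "f v = g v + f 0" for v by (metis add_diff_cancel_left' diff_add_cancel diff_zero add.commute)
  then show ?thesis using that lin g(2) bounded_linear.linear by blast
qed

lemma entire_map_quasi_additive:
  fixes F :: "complex^'n \<Rightarrow> complex^'m"
  assumes "entire_map F" "\<And>x y. F (x + y) = F x + F y + c"
  obtains a where "clinear a" "\<And>v. F v = a v + F 0"
proof -
  have "\<exists>g. linear g \<and> (\<forall>c v. g (c *s v) = c * g v) \<and> (\<forall>v. F v $ i = g v + F 0 $ i)" for i
  proof -
    have "entire (\<lambda>v. F v $ i)" using assms(1) by (simp add: entire_map_def)
    moreover have "F (x + y) $ i = F x $ i + F y $ i + c $ i" for x y by (simp add: assms(2))
    ultimately obtain g where "linear g" "\<And>c v. g (c *s v) = c * g v" "\<And>v. F v $ i = g v + F 0 $ i"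
      using entire_quasi_additive[of "\<lambda>v. F v $ i" "c $ i"] by metis
    then show ?thesis by blast
  qed
  then obtain g where g: "\<And>i. linear (g i)" "\<And>i c v. g i (c *s v) = c * g i v"
    "\<And>i v. F v $ i = g i v + F 0 $ i" by metis
  show ?thesis
  proof (rule that)
    show "clinear (\<lambda>v. \<chi> i. g i v)"
      unfolding clinear_def
      by (auto intro!: linearI simp: vec_eq_iff g(2) linear_add[OF g(1)] linear_scale[OF g(1)])
    show "F v = (\<chi> i. g i v) + F 0" for v
      unfolding vec_eq_iff vector_add_component vec_lambda_beta using g(3) by blast
  qed
qed

lemma entire_map_continuous: "entire_map F \<Longrightarrow> continuous_on UNIV F"
  using continuous_on_vec_lambda[of UNIV "\<lambda>i v. F v $ i"]
  by (simp add: entire_map_def entire_imp_continuous)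

text \<open>The defect of additivity is continuous in (x, y) with values in a countable set, hence
  constant. Countability thus stands in for the discreteness of lattices.\<close>

lemma entire_map_additive_mod_countable:
  fixes F :: "complex^'n \<Rightarrow> complex^'m"
  assumes "entire_map F" "\<And>x y. F (x + y) - (F x + F y) \<in> C" "countable C"
  obtains a where "clinear a" "\<And>v. F v = a v + F 0"
proof -
  let ?f = "\<lambda>p. F (fst p + snd p) - (F (fst p) + F (snd p))"
  have "continuous_on UNIV ?f"
    by (intro continuous_intros continuous_on_compose2[OF entire_map_continuous[OF assms(1)]]) auto
  then have "?f p = ?f (0, 0)" for p
    by (rule continuous_countable_range_constant[of ?f C]) (use assms in auto)
  then have "?f (x, y) = ?f (0, 0)" for x y by blast
  then have "F (x + y) = F x + F y + (- F 0)" for x y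
    by (simp add: algebra_simps)
  then show ?thesis using entire_map_quasi_additive[OF assms(1)] that by blast
qed

text \<open>Lifts are mutually inverse only modulo the lattices: b (a v) - v plus a constant lies in
  L. Countability of L makes this expression constant, and comparison with v = 0 gives b (a v) =
  v.\<close>

lemma torus_iso_affine:
  fixes L :: "(complex^'n) set" and L' :: "(complex^'m) set"
  assumes "lattice_in L" "lattice_in L'" "torus_iso L L' F"
  obtains a b where "clinear a" "clinear b" "\<And>v. b (a v) = v" "\<And>w. a (b w) = w"
    "a ` L = L'" "\<And>v. F v = a v + F 0"
proof -
  obtain G where G: "torus_hom L' L G" "\<And>v. G (F v) - v \<in> L" "\<And>w. F (G w) - w \<in> L'"
    and F: "torus_hom L L' F" using assms(3) unfolding torus_iso_def by blast
  have cnt: "countable L" "countable L'" using assms lattice_countable by auto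
  obtain a where a: "clinear a" "\<And>v. F v = a v + F 0"
    using F entire_map_additive_mod_countable[of F L'] cnt unfolding torus_hom_def by blast
  obtain b where b: "clinear b" "\<And>v. G v = b v + G 0"
    using G(1) entire_map_additive_mod_countable[of G L] cnt unfolding torus_hom_def by blast
  have lin: "linear a" "linear b" using a b by (auto simp: clinear_def)
  have ca: "continuous_on UNIV a" "continuous_on UNIV b"
    using lin by (auto intro: linear_continuous_on simp: linear_conv_bounded_linear)
  have ba: "b (a v) = v" for v
  proof -
    have "G (F v) - v = b (a v) - v + (b (F 0) + G 0)" for v
      using a(2)[of v] b(2)[of "F v"] linear_add[OF lin(2), of "a v" "F 0"] by simp
    then have r: "range (\<lambda>v. b (a v) - v + (b (F 0) + G 0)) \<subseteq> L"
      using G(2) by (intro image_subsetI) metis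
    have "continuous_on UNIV (\<lambda>v. b (a v) - v + (b (F 0) + G 0))"
      by (intro continuous_intros continuous_on_compose2[OF ca(2) ca(1)]) auto
    from this r have "b (a v) - v + (b (F 0) + G 0) = b (a 0) - 0 + (b (F 0) + G 0)"
      using cnt(1) by (rule continuous_countable_range_constant)
    then show ?thesis using lin by (simp add: linear_0)
  qed
  have ab: "a (b v) = v" for v
  proof -
    have "F (G v) - v = a (b v) - v + (a (G 0) + F 0)" for v
      using b(2)[of v] a(2)[of "G v"] linear_add[OF lin(1), of "b v" "G 0"] by simp
    then have r: "range (\<lambda>v. a (b v) - v + (a (G 0) + F 0)) \<subseteq> L'"
      using G(3) by (intro image_subsetI) metis
    have "continuous_on UNIV (\<lambda>v. a (b v) - v + (a (G 0) + F 0))"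
      by (intro continuous_intros continuous_on_compose2[OF ca(1) ca(2)]) auto
    from this r have "a (b v) - v + (a (G 0) + F 0) = a (b 0) - 0 + (a (G 0) + F 0)"
      using cnt(2) by (rule continuous_countable_range_constant)
    then show ?thesis using lin by (simp add: linear_0)
  qed
  have aL: "a l \<in> L'" if "l \<in> L" for l
    using F that a(2)[of l] unfolding torus_hom_def by (metis add_diff_cancel_right' add_0)
  have bL: "b l \<in> L" if "l \<in> L'" for l
    using G(1) that b(2)[of l] unfolding torus_hom_def by (metis add_diff_cancel_right' add_0)
  have "a ` L = L'" using aL bL ab by (metis (no_types) image_eqI image_subsetI subsetI subset_antisym)
  then show ?thesis using that a b ba ab by blast
qed

section \<open>Isomorphisms to the dual and Riemann forms\<close>

definition antilinear_pairing :: "complex^'n \<Rightarrow> complex^'n \<Rightarrow> real" where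
  "antilinear_pairing w v = Im (\<Sum>i\<in>UNIV. w $ i * cnj (v $ i))"

lemma bilinear_antilinear_pairing: "bilinear antilinear_pairing"
  unfolding bilinear_def antilinear_pairing_def
  by (auto intro!: linearI simp: algebra_simps sum.distrib sum_distrib_left sum_subtractf)

lemma antilinear_pairing_i: "antilinear_pairing (\<i> *s w) (\<i> *s v) = antilinear_pairing w v"
  unfolding antilinear_pairing_def by (intro arg_cong[of _ _ Im] sum.cong) (auto simp: complex_eq_iff)

lemma antilinear_pairing_nondegenerate:
  assumes "\<And>v. antilinear_pairing w v = 0"
  shows "w = 0"
proof -
  have "antilinear_pairing w (axis i c) = Im (w $ i * cnj c)" for i c
    unfolding antilinear_pairing_def
    by (simp add: axis_def if_distrib[of cnj] if_distrib[of "(*) _"] cong: if_cong)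
  from this[of _ 1] this[of _ \<i>] show ?thesis
    using assms by (simp add: vec_eq_iff complex_eq_iff)
qed

lemma flat_bundle_eq: "flat_bundle w = character_bundle (antilinear_pairing w)"
  by (simp add: flat_bundle_def character_bundle_def antilinear_pairing_def)

lemma tensor_flat_bundle: "tensor (flat_bundle w) (flat_bundle w') = flat_bundle (w + w')"
  by (simp add: flat_bundle_eq tensor_def character_bundle_def fun_eq_iff bilinear_ladd[OF bilinear_antilinear_pairing]
      algebra_simps flip: exp_add)

lemma flat_bundle_0: "flat_bundle 0 = trivial_bundle"
  by (simp add: flat_bundle_eq trivial_bundle_def character_bundle_def bilinear_lzero[OF bilinear_antilinear_pairing])

text \<open>For a lattice L this is the kernel of the covering w -> \<open>flat_bundle w\<close> of
  the dual variety, so it is the lattice of the dual torus.\<close>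

definition dual_lattice :: "(complex^'n) set \<Rightarrow> (complex^'n) set" where
  "dual_lattice L = {w. \<forall>l\<in>L. antilinear_pairing w l \<in> \<int>}"

lemma dual_lattice_add: "w \<in> dual_lattice L \<Longrightarrow> w' \<in> dual_lattice L \<Longrightarrow> w + w' \<in> dual_lattice L"
  by (simp add: dual_lattice_def bilinear_ladd[OF bilinear_antilinear_pairing])

lemma dual_lattice_uminus: "w \<in> dual_lattice L \<Longrightarrow> - w \<in> dual_lattice L"
  by (simp add: dual_lattice_def bilinear_lneg[OF bilinear_antilinear_pairing])

lemma flat_bundle_iso_iff:
  assumes "cobounded L"
  shows "bundle_iso L (flat_bundle w) (flat_bundle w') \<longleftrightarrow> w' - w \<in> dual_lattice L"
  by (simp add: flat_bundle_eq character_bundle_iso_iff[OF assms] dual_lattice_def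
      bilinear_lsub[OF bilinear_antilinear_pairing])

text \<open>An element is determined by its integral pairings with a real basis contained in
  L.\<close>

lemma dual_lattice_countable:
  fixes L :: "(complex^'n) set"
  assumes "lattice_in L"
  shows "countable (dual_lattice L)"
proof -
  obtain B where BL: "B \<subseteq> L" "independent B" "L \<subseteq> span B"
    by (rule basis_exists)
  have "span L \<subseteq> span B" by (rule span_minimal[OF BL(3) subspace_span])
  then have span: "span B = UNIV" unfolding lattice_span[OF assms] by (simp add: top.extremum_unique)
  have B: "finite B" using BL(2) by (rule finiteI_independent)
  let ?r = "\<lambda>w. restrict (antilinear_pairing w) B"
  have "inj_on ?r (dual_lattice L)"
  proof (rule inj_onI)
    fix w w' assume "?r w = ?r w'"
    then have "antilinear_pairing w b = antilinear_pairing w' b" if "b \<in> B" for b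
      using that by (metis restrict_apply')
    then have "antilinear_pairing (w - w') b = 0" if "b \<in> B" for b
      using that by (simp add: bilinear_lsub[OF bilinear_antilinear_pairing])
    moreover have "linear (antilinear_pairing (w - w'))"
      using bilinear_antilinear_pairing unfolding bilinear_def by blast
    ultimately have "antilinear_pairing (w - w') v = 0" for v
      using linear_eq_0_on_span[of "antilinear_pairing (w - w')" B v] span by auto
    then show "w = w'" using antilinear_pairing_nondegenerate by force
  qed
  moreover have "?r ` dual_lattice L \<subseteq> B \<rightarrow>\<^sub>E \<int>"
    using BL by (auto simp: dual_lattice_def)
  moreover have "countable (B \<rightarrow>\<^sub>E (\<int> :: real set))"
    by (intro countable_PiE B) (auto simp: Ints_def)
  ultimately show ?thesis
    by (meson countable_image_inj_on countable_subset)
qed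

text \<open>With a the linear part of the lift F, the form is b x y =
  \<open>antilinear_pairing (a x) y\<close>. The kernel condition on F says that x is in L exactly
  when a x is in the dual lattice, which is unimodularity. Invariance under i holds because a is
  complex linear and the factors i and its conjugate cancel in the pairing.\<close>

lemma isomorphic_to_dual_imp_form:
  fixes L :: "(complex^'n) set"
  assumes "lattice_in L" "isomorphic_to_dual L"
  shows "\<exists>b :: complex^'n \<Rightarrow> complex^'n \<Rightarrow> real. bilinear b \<and> (\<forall>x y. b (\<i> *s x) (\<i> *s y) = b x y) \<and> (\<forall>x. x \<in> L \<longleftrightarrow> (\<forall>l\<in>L. b x l \<in> \<int>))"
proof -
  have L: "cobounded L" using assms(1) by (rule lattice_cobounded)
  obtain F where F: "entire_map F"
    "\<And>x y. bundle_iso L (flat_bundle (F (x + y))) (tensor (flat_bundle (F x)) (flat_bundle (F y)))"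
    "\<And>x. bundle_iso L (flat_bundle (F x)) trivial_bundle \<longleftrightarrow> x \<in> L"
    using assms(2) unfolding isomorphic_to_dual_def by blast
  have "F (x + y) - (F x + F y) \<in> dual_lattice L" for x y
  proof -
    have "F x + F y - F (x + y) \<in> dual_lattice L"
      using F(2)[of x y] by (simp add: tensor_flat_bundle flat_bundle_iso_iff[OF L])
    from dual_lattice_uminus[OF this] show ?thesis by (simp add: algebra_simps)
  qed
  from entire_map_additive_mod_countable[OF F(1) this dual_lattice_countable[OF assms(1)]]
  obtain a where a: "clinear a" "\<And>v. F v = a v + F 0" by blast
  have mem: "x \<in> L \<longleftrightarrow> F x \<in> dual_lattice L" for x
    using F(3)[of x] flat_bundle_iso_iff[OF L, of "F x" 0] dual_lattice_uminus[of "F x" L]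
      dual_lattice_uminus[of "- F x" L] by (auto simp: flat_bundle_0)
  then have F0: "F 0 \<in> dual_lattice L" using lattice_zero[OF assms(1)] by blast
  have "F x \<in> dual_lattice L \<longleftrightarrow> a x \<in> dual_lattice L" for x
  proof
    assume "F x \<in> dual_lattice L"
    then have "F x + - F 0 \<in> dual_lattice L" by (rule dual_lattice_add[OF _ dual_lattice_uminus[OF F0]])
    moreover have "F x + - F 0 = a x" using a(2)[of x] by simp
    ultimately show "a x \<in> dual_lattice L" by metis
  next
    assume "a x \<in> dual_lattice L"
    from dual_lattice_add[OF this F0] show "F x \<in> dual_lattice L" unfolding a(2)[symmetric] .
  qed
  then have "x \<in> L \<longleftrightarrow> a x \<in> dual_lattice L" for x
    using mem by blast
  then have lattice: "x \<in> L \<longleftrightarrow> (\<forall>l\<in>L. antilinear_pairing (a x) l \<in> \<int>)" for x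
    unfolding dual_lattice_def mem_Collect_eq .
  have bilin: "bilinear (\<lambda>x. antilinear_pairing (a x))"
    using bilinear_antilinear_pairing a(1) unfolding bilinear_def clinear_def
    by (auto intro: linear_compose[unfolded comp_def])
  have "antilinear_pairing (a (\<i> *s x)) (\<i> *s y) = antilinear_pairing (a x) y" for x y
    using a(1) by (simp add: clinear_def antilinear_pairing_i)
  with bilin lattice show ?thesis by (intro exI[of _ "\<lambda>x. antilinear_pairing (a x)"]) blast
qed

text \<open>The Riemann form of a line bundle \<open>e\<close>, characterised by the fact that \<open>phi e x\<close> is the flat line
  bundle with character \<open>exp (2 \<pi> i E x l)\<close>. This avoids logarithms of the factor \<open>e\<close>.\<close>

definition riemann_form ::
    "(complex^'n) set \<Rightarrow> 'n factor \<Rightarrow> (complex^'n \<Rightarrow> complex^'n \<Rightarrow> real) \<Rightarrow> bool" where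
  "riemann_form L e E \<longleftrightarrow> (\<forall>x. bundle_iso L (phi e x) (character_bundle (E x)))"

text \<open>Isomorphic characters differ by integers on L, and linearity in x leaves only the
  difference 0. The second argument is confined to L because a character is seen only there.\<close>

lemma riemann_form_unique:
  assumes "cobounded L" "bilinear E" "bilinear E'" "riemann_form L e E" "riemann_form L e E'" "l \<in> L"
  shows "E x l = E' x l"
proof -
  have "bundle_iso L (character_bundle (E x)) (character_bundle (E' x))" for x
    using assms(4,5) unfolding riemann_form_def by (meson bundle_iso_sym bundle_iso_trans)
  then have "E' x l - E x l \<in> \<int>" for x
    using assms(1,6) by (simp add: character_bundle_iso_iff)
  moreover have "linear (\<lambda>x. E' x l - E x l)"
    using assms(2,3) unfolding bilinear_def by (intro linear_compose_sub) auto
  ultimately have "E' x l - E x l = 0"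
    by (rule integer_valued_linear_zero[rotated])
  then show ?thesis by simp
qed

text \<open>The function h that identifies the translate of \<open>tensor e (dual_bundle e')\<close>
  with the bundle itself also works once the factors e and e' are moved to opposite sides.\<close>

lemma NS_equiv_phi:
  assumes "NS_equiv L e e'"
  shows "bundle_iso L (phi e x) (phi e' x)"
proof -
  let ?g = "tensor e (dual_bundle e')"
  have g: "line_bundle L ?g" "bundle_iso L (translate x ?g) ?g"
    using assms by (auto simp: NS_equiv_def Pic0_def)
  then obtain h where h: "entire h" "\<And>v. h v \<noteq> 0"
    "\<And>l v. l \<in> L \<Longrightarrow> ?g l v * h v = h (v + l) * translate x ?g l v"
    unfolding bundle_iso_def by blast
  have "phi e' x l v * h v = h (v + l) * phi e x l v" if "l \<in> L" for l v
  proof -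
    have "e l w \<noteq> 0" "e' l w \<noteq> 0" for w
      using g(1) that by (auto simp: line_bundle_def tensor_def dual_bundle_def)
    then show ?thesis
      using h(3)[OF that, of v] by (simp add: phi_def tensor_def dual_bundle_def translate_def field_simps)
  qed
  then show ?thesis unfolding bundle_iso_def using h by blast
qed

lemma riemann_form_NS_equiv:
  assumes "NS_equiv L e e'"
  shows "riemann_form L e E \<longleftrightarrow> riemann_form L e' E"
  unfolding riemann_form_def using NS_equiv_phi[OF assms] by (meson bundle_iso_sym bundle_iso_trans)

text \<open>Isomorphisms of bundles are carried along the affine map v -> a v + F 0 and its inverse
  w -> b (w - F 0). The translation part does not touch the characters, which see only the periods a
  l.\<close>

lemma riemann_form_pullback:
  fixes L :: "(complex^'n) set" and L' :: "(complex^'m) set"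
  assumes "clinear a" "clinear b" "\<And>v. b (a v) = v" "\<And>w. a (b w) = w"
    and "a ` L = L'" "\<And>v. F v = a v + F 0"
  shows "riemann_form L (pullback F e) (\<lambda>x y. E (a x) (a y)) \<longleftrightarrow> riemann_form L' e E"
proof -
  have add: "a (v + w) = a v + a w" "b (v' + w') = b v' + b w'" for v w v' w'
    using assms(1,2) by (auto simp: clinear_def linear_add)
  have per: "F (v + l) - F v = a l" for v l
    using assms(6)[of "v + l"] assms(6)[of v] by (simp add: add)
  have "pullback F e l v = e (a l) (a v + F 0)" for l v
    unfolding pullback_def per using assms(6)[of v] by simp
  then have phi: "phi (pullback F e) x l v = phi e (a x) (a l) (a v + F 0)" for x l v
    by (simp add: phi_def tensor_def dual_bundle_def translate_def add ac_simps)
  have "bundle_iso L (phi (pullback F e) x) (character_bundle (\<lambda>y. E (a x) (a y))) \<longleftrightarrow>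
    bundle_iso L' (phi e (a x)) (character_bundle (E (a x)))" (is "?A \<longleftrightarrow> ?B") for x
  proof
    assume ?A
    then obtain h where h: "entire h" "\<And>v. h v \<noteq> 0" "\<And>l v. l \<in> L \<Longrightarrow>
        character_bundle (\<lambda>y. E (a x) (a y)) l v * h v = h (v + l) * phi e (a x) (a l) (a v + F 0)"
      unfolding bundle_iso_def phi by blast
    have "character_bundle (E (a x)) l' w * h (b w + b (- F 0)) = h (b (w + l') + b (- F 0)) * phi e (a x) l' w"
      if l': "l' \<in> L'" for l' w
    proof -
      obtain l where l: "l \<in> L" "l' = a l" using l' assms(5) by blast
      have "a (b w + b (- F 0)) + F 0 = w" by (simp add: add assms(4))
      then show ?thesis
        using h(3)[OF l(1), of "b w + b (- F 0)"] by (simp add: l add assms(3) character_bundle_def algebra_simps)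
    qed
    then show ?B unfolding bundle_iso_def
      using h(2) by (intro exI[of _ "\<lambda>w. h (b w + b (- F 0))"]) (auto simp: entire_compose_affine h(1) assms(2))
  next
    assume ?B
    then obtain h where h: "entire h" "\<And>v. h v \<noteq> 0" "\<And>l v. l \<in> L' \<Longrightarrow>
        character_bundle (E (a x)) l v * h v = h (v + l) * phi e (a x) l v"
      unfolding bundle_iso_def by blast
    have "character_bundle (\<lambda>y. E (a x) (a y)) l v * h (a v + F 0) =
        h (a (v + l) + F 0) * phi e (a x) (a l) (a v + F 0)" if "l \<in> L" for l v
      using h(3)[of "a l" "a v + F 0"] that assms(5) by (auto simp: add character_bundle_def algebra_simps)
    then show ?A unfolding bundle_iso_def phi
      using h(2) by (intro exI[of _ "\<lambda>v. h (a v + F 0)"]) (auto simp: entire_compose_affine h(1) assms(1))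
  qed
  then have "riemann_form L (pullback F e) (\<lambda>x y. E (a x) (a y)) \<longleftrightarrow>
    (\<forall>x. bundle_iso L' (phi e (a x)) (character_bundle (E (a x))))"
    unfolding riemann_form_def by simp
  also have "\<dots> \<longleftrightarrow> riemann_form L' e E"
    unfolding riemann_form_def using assms(4) by metis
  finally show ?thesis .
qed

section \<open>The Siegel family\<close>

definition vec_Re :: "complex^'n \<Rightarrow> real^'n" where
  "vec_Re x = (\<chi> i. Re (x $ i))"

definition vec_Im :: "complex^'n \<Rightarrow> real^'n" where
  "vec_Im x = (\<chi> i. Im (x $ i))"

lemma linear_vec_Re: "linear vec_Re" and linear_vec_Im: "linear vec_Im"
  by (auto intro!: linearI simp: vec_Re_def vec_Im_def vec_eq_iff)

lemma vec_Re_axis [simp]: "vec_Re (axis i 1) = axis i 1"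
  and vec_Im_axis [simp]: "vec_Im (axis i 1) = 0"
  by (simp_all add: vec_Re_def vec_Im_def vec_eq_iff axis_def)

lemma vec_Re_i [simp]: "vec_Re (\<i> *s x) = - vec_Im x"
  and vec_Im_i [simp]: "vec_Im (\<i> *s x) = vec_Re x"
  by (simp_all add: vec_Re_def vec_Im_def vec_eq_iff)

lemma axis_1_nth: "axis i (1 :: 'a::zero_neq_one) $ m = (if m = i then 1 else 0)"
  by (simp add: axis_def)

text \<open>For \<tau> in \<open>Siegel\<close>, the vector p in the decomposition x = \<tau> p + q
  with p and q real; on the lattice it is the integral p of \<open>Siegel_bundle\<close>.\<close>

definition siegel_p :: "complex^'n^'n \<Rightarrow> complex^'n \<Rightarrow> real^'n" where
  "siegel_p \<tau> x = matrix_inv (Im_mat \<tau>) *v vec_Im x"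

text \<open>For x = \<tau> p + q and y = \<tau> p' + q' with \<tau> in \<open>Siegel\<close> this is
  p . q' - p' . q; the contributions of Re \<tau> cancel by symmetry.\<close>

definition siegel_form :: "complex^'n^'n \<Rightarrow> complex^'n \<Rightarrow> complex^'n \<Rightarrow> real" where
  "siegel_form \<tau> x y = siegel_p \<tau> x \<bullet> vec_Re y - siegel_p \<tau> y \<bullet> vec_Re x"

definition siegel_e :: "complex^'n^'n \<Rightarrow> 'n \<Rightarrow> complex^'n" where
  "siegel_e \<tau> i = (\<chi> m. \<tau> $ m $ i)"

lemma linear_siegel_p: "linear (siegel_p \<tau>)"
  unfolding siegel_p_def
  by (intro linear_compose[OF linear_vec_Im matrix_vector_mul_linear, unfolded comp_def])

lemma bilinear_siegel_form: "bilinear (siegel_form \<tau>)"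
  unfolding bilinear_def siegel_form_def
  by (auto intro!: linearI simp: linear_add[OF linear_siegel_p] linear_add[OF linear_vec_Re]
     linear_scale[OF linear_siegel_p] linear_scale[OF linear_vec_Re] inner_add_left inner_add_right algebra_simps)

lemma siegel_form_swap: "siegel_form \<tau> y x = - siegel_form \<tau> x y"
  by (simp add: siegel_form_def)

lemma Siegel_sym: "\<tau> \<in> Siegel \<Longrightarrow> \<tau> $ i $ j = \<tau> $ j $ i"
  by (auto simp: Siegel_def transpose_def vec_eq_iff)

lemma Siegel_pos: "\<tau> \<in> Siegel \<Longrightarrow> x \<noteq> 0 \<Longrightarrow> x \<bullet> (Im_mat \<tau> *v x) > 0"
  by (auto simp: Siegel_def)

lemma Siegel_invertible:
  assumes "\<tau> \<in> Siegel"
  shows "invertible (Im_mat \<tau>)"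
  unfolding invertible_left_inverse matrix_left_invertible_ker
  using Siegel_pos[OF assms] by (metis inner_zero_right less_irrefl)

lemma matrix_inv_mult:
  assumes "invertible (A :: real^'n^'n)"
  shows "A ** matrix_inv A = mat 1" "matrix_inv A ** A = mat 1"
proof -
  have "A ** matrix_inv A = mat 1 \<and> matrix_inv A ** A = mat 1"
    using assms unfolding invertible_def matrix_inv_def by (rule someI_ex)
  then show "A ** matrix_inv A = mat 1" "matrix_inv A ** A = mat 1" by auto
qed

lemma Im_mat_siegel_p: "\<tau> \<in> Siegel \<Longrightarrow> Im_mat \<tau> *v siegel_p \<tau> x = vec_Im x"
  by (simp add: siegel_p_def matrix_vector_mul_assoc matrix_inv_mult Siegel_invertible)

lemma siegel_p_eqI: "\<tau> \<in> Siegel \<Longrightarrow> vec_Im x = Im_mat \<tau> *v r \<Longrightarrow> siegel_p \<tau> x = r"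
  by (simp add: siegel_p_def matrix_vector_mul_assoc matrix_inv_mult Siegel_invertible)

lemma Im_mat_sym: "\<tau> \<in> Siegel \<Longrightarrow> x \<bullet> (Im_mat \<tau> *v y) = y \<bullet> (Im_mat \<tau> *v x)"
proof -
  assume "\<tau> \<in> Siegel"
  then have "transpose (Im_mat \<tau>) = Im_mat \<tau>"
    by (simp add: vec_eq_iff transpose_def Im_mat_def Siegel_sym)
  then show ?thesis by (metis dot_lmul_matrix inner_commute transpose_matrix_vector)
qed

lemma siegel_form_f: "siegel_form \<tau> x (axis i 1) = siegel_p \<tau> x $ i"
  by (simp add: siegel_form_def siegel_p_def inner_axis)

lemma siegel_p_e:
  assumes "\<tau> \<in> Siegel"
  shows "siegel_p \<tau> (siegel_e \<tau> i) = axis i 1"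
  by (rule siegel_p_eqI[OF assms])
    (simp add: vec_eq_iff vec_Im_def siegel_e_def matrix_vector_mult_def Im_mat_def axis_def if_distrib cong: if_cong)

lemma siegel_form_e:
  assumes "\<tau> \<in> Siegel"
  shows "siegel_form \<tau> x (siegel_e \<tau> i) = siegel_p \<tau> x \<bullet> vec_Re (siegel_e \<tau> i) - Re (x $ i)"
  by (simp add: siegel_form_def siegel_p_e[OF assms] inner_axis' vec_Re_def)

text \<open>Only the expansion property is required; it implies that \<open>e\<close>, \<open>f\<close> generate the space but not that they
  are independent.\<close>

definition symplectic_frame :: "('a::real_vector \<Rightarrow> 'a \<Rightarrow> real) \<Rightarrow> ('i::finite \<Rightarrow> 'a) \<Rightarrow> ('i \<Rightarrow> 'a) \<Rightarrow> bool" where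
  "symplectic_frame E e f \<longleftrightarrow> (\<forall>x. x = (\<Sum>i\<in>UNIV. E x (f i) *\<^sub>R e i - E x (e i) *\<^sub>R f i))"

lemma siegel_symplectic_frame:
  fixes \<tau> :: "complex^'n^'n"
  assumes "\<tau> \<in> Siegel"
  shows "symplectic_frame (siegel_form \<tau>) (siegel_e \<tau>) (\<lambda>i. axis i 1)"
  unfolding symplectic_frame_def
proof
  fix x :: "complex^'n"
  let ?p = "siegel_p \<tau> x"
  have "(\<Sum>i\<in>UNIV. siegel_form \<tau> x (axis i 1) *\<^sub>R siegel_e \<tau> i -
      siegel_form \<tau> x (siegel_e \<tau> i) *\<^sub>R axis i 1) $ m = x $ m" (is "?l $ m = _") for m
  proof -
    have "?l $ m = (\<Sum>i\<in>UNIV. ?p $ i *\<^sub>R \<tau> $ m $ i) -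
        of_real (?p \<bullet> vec_Re (siegel_e \<tau> m) - Re (x $ m))"
    proof -
      have "siegel_e \<tau> i $ m = \<tau> $ m $ i" for i by (simp add: siegel_e_def)
      moreover have "(\<Sum>i\<in>UNIV. r i *\<^sub>R (if m = i then 1 else 0)) = complex_of_real (r m)" for r
        by (simp add: if_distrib[of "(*) _"] scaleR_conv_of_real[where 'a = complex] cong: if_cong)
      ultimately show ?thesis
        by (simp add: siegel_form_f siegel_form_e[OF assms] sum_subtractf axis_1_nth del: of_real_diff)
    qed
    moreover have "(\<Sum>i\<in>UNIV. ?p $ i * Re (\<tau> $ m $ i)) = ?p \<bullet> vec_Re (siegel_e \<tau> m)"
      by (simp add: inner_vec_def vec_Re_def siegel_e_def Siegel_sym[OF assms, of m])
    moreover have "(\<Sum>i\<in>UNIV. ?p $ i * Im (\<tau> $ m $ i)) = Im (x $ m)"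
    proof -
      have "(Im_mat \<tau> *v ?p) $ m = Im (x $ m)"
        by (simp add: Im_mat_siegel_p[OF assms] vec_Im_def)
      then show ?thesis by (simp add: matrix_vector_mult_def Im_mat_def mult.commute)
    qed
    ultimately show ?thesis by (simp add: complex_eq_iff)
  qed
  then show "x = ?l" by (simp add: vec_eq_iff)
qed

text \<open>The exponent of the factor is affine in v, so \<open>phi\<close> is the constant exp (-2
  pi i p_l . x), in general not of absolute value 1. The function h v = exp (2 pi i p_x . v) changes
  it into exp (2 pi i (p_x . l - p_l . x)), and p_x . l - p_l . x is real because Im \<tau> is
  symmetric.\<close>

lemma riemann_form_Siegel:
  fixes \<tau> :: "complex^'n^'n"
  assumes "\<tau> \<in> Siegel"
  shows "riemann_form L (Siegel_bundle \<tau>) (siegel_form \<tau>)"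
  unfolding riemann_form_def bundle_iso_def
proof (intro allI)
  fix x :: "complex^'n"
  define D where "D r v = (\<Sum>i\<in>UNIV. complex_of_real (r $ i) * v $ i)" for r :: "real^'n" and v
  have D_add: "D r (v + w) = D r v + D r w" for r v w
    by (simp add: D_def algebra_simps sum.distrib)
  have E: "of_real (siegel_form \<tau> x l) = D (siegel_p \<tau> x) l - D (siegel_p \<tau> l) x" for l
  proof -
    have "siegel_p \<tau> x \<bullet> vec_Im l = siegel_p \<tau> l \<bullet> vec_Im x"
      using Im_mat_sym[OF assms] by (metis Im_mat_siegel_p[OF assms])
    then have "(\<Sum>i\<in>UNIV. siegel_p \<tau> x $ i * Im (l $ i)) = (\<Sum>i\<in>UNIV. siegel_p \<tau> l $ i * Im (x $ i))"
      by (simp add: inner_vec_def vec_Im_def)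
    then show ?thesis
      by (simp add: complex_eq_iff D_def siegel_form_def inner_vec_def vec_Re_def)
  qed
  define A where "A l = (\<Sum>i\<in>UNIV. complex_of_real (siegel_p \<tau> l $ i) *
      (\<tau> *v (\<chi> i. complex_of_real (siegel_p \<tau> l $ i))) $ i)" for l
  have e: "Siegel_bundle \<tau> l v = exp (- of_real pi * \<i> * A l - 2 * of_real pi * \<i> * D (siegel_p \<tau> l) v)" for l v
    by (simp add: Siegel_bundle_def Let_def A_def D_def siegel_p_def vec_Im_def)
  have phi: "phi (Siegel_bundle \<tau>) x l v = exp (- 2 * of_real pi * \<i> * D (siegel_p \<tau> l) x)" for l v
    by (simp add: phi_def tensor_def translate_def dual_bundle_def e D_add algebra_simps flip: exp_add exp_minus)
  show "\<exists>h. entire h \<and> (\<forall>v. h v \<noteq> 0) \<and> (\<forall>l\<in>L. \<forall>v. character_bundle (siegel_form \<tau> x) l v * h v =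
      h (v + l) * phi (Siegel_bundle \<tau>) x l v)"
  proof (intro exI[of _ "\<lambda>v. exp (2 * of_real pi * \<i> * D (siegel_p \<tau> x) v)"] conjI allI ballI)
    show "entire (\<lambda>v. exp (2 * of_real pi * \<i> * D (siegel_p \<tau> x) v))"
    proof (rule entire_exp_linear)
      show "2 * of_real pi * \<i> * D (siegel_p \<tau> x) (c *s v) = c * (2 * of_real pi * \<i> * D (siegel_p \<tau> x) v)" for c v
        by (simp add: D_def sum_distrib_left algebra_simps)
      show "linear (\<lambda>v. 2 * of_real pi * \<i> * D (siegel_p \<tau> x) v)"
        by (rule linearI) (auto simp: D_def sum_distrib_left algebra_simps sum.distrib scaleR_conv_of_real[where 'a = complex])
    qed
    show "character_bundle (siegel_form \<tau> x) l v * exp (2 * of_real pi * \<i> * D (siegel_p \<tau> x) v) =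
      exp (2 * of_real pi * \<i> * D (siegel_p \<tau> x) (v + l)) * phi (Siegel_bundle \<tau>) x l v" for l v
      unfolding phi character_bundle_def E
      by (simp add: D_add algebra_simps flip: exp_add)
  qed simp
qed

section \<open>The Siegel lattices and their standard bases\<close>

definition siegel_basis :: "('n::finite \<Rightarrow> nat) \<Rightarrow> complex^'n^'n \<Rightarrow> 'n + 'n \<Rightarrow> complex^'n" where
  "siegel_basis d \<tau> = case_sum (siegel_e \<tau>) (\<lambda>i. of_nat (d i) *\<^sub>R axis i 1)"

lemma sum_UNIV_Plus:
  "(\<Sum>a\<in>(UNIV :: ('a::finite + 'b::finite) set). g a) = (\<Sum>i\<in>UNIV. g (Inl i)) + (\<Sum>i\<in>UNIV. g (Inr i))"
  using sum.Plus[of "UNIV :: 'a set" "UNIV :: 'b set" g] by simp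

lemma Siegel_lattice_eq:
  "Siegel_lattice d \<tau> = {\<Sum>a\<in>UNIV. of_int (k a) *\<^sub>R siegel_basis d \<tau> a | k :: 'n::finite + 'n \<Rightarrow> int. True}"
proof -
  have eq: "\<tau> *v (\<chi> i. of_int (p i)) + (\<chi> i. of_nat (d i) * of_int (q i)) =
      (\<Sum>a\<in>UNIV. of_int (case_sum p q a) *\<^sub>R siegel_basis d \<tau> a)" for p q :: "'n \<Rightarrow> int"
    by (simp add: sum_UNIV_Plus siegel_basis_def vec_eq_iff matrix_vector_mult_def siegel_e_def axis_1_nth
        scaleR_conv_of_real[where 'a = complex] if_distrib[of "(*) _"] if_distrib[of "\<lambda>x. x * _"] mult.commute cong: if_cong)
  show ?thesis
  proof (intro Set.set_eqI iffI)
    fix x assume "x \<in> Siegel_lattice d \<tau>"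
    then show "x \<in> {\<Sum>a\<in>UNIV. of_int (k a) *\<^sub>R siegel_basis d \<tau> a | k :: 'n + 'n \<Rightarrow> int. True}"
      unfolding Siegel_lattice_def eq by blast
  next
    fix x assume "x \<in> {\<Sum>a\<in>UNIV. of_int (k a) *\<^sub>R siegel_basis d \<tau> a | k :: 'n + 'n \<Rightarrow> int. True}"
    then obtain k :: "'n + 'n \<Rightarrow> int" where "x = (\<Sum>a\<in>UNIV. of_int (k a) *\<^sub>R siegel_basis d \<tau> a)" by blast
    moreover have "case_sum (k \<circ> Inl) (k \<circ> Inr) = k" by (simp add: fun_eq_iff split: sum.split)
    ultimately show "x \<in> Siegel_lattice d \<tau>"
      unfolding Siegel_lattice_def eq mem_Collect_eq
      by (intro exI[of _ "k \<circ> Inl"] exI[of _ "k \<circ> Inr"]) simp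
  qed
qed

lemma siegel_basis_in_lattice: "siegel_basis d \<tau> a \<in> Siegel_lattice d \<tau>"
proof -
  have "siegel_basis d \<tau> a = (\<Sum>c\<in>UNIV. of_int (if c = a then 1 else 0) *\<^sub>R siegel_basis d \<tau> c)"
    by (simp add: if_distrib[of "\<lambda>r. r *\<^sub>R _"] if_distrib[of of_int] cong: if_cong)
  then show ?thesis unfolding Siegel_lattice_eq mem_Collect_eq by (intro exI conjI TrueI)
qed

lemma siegel_basis_expansion:
  assumes "\<tau> \<in> Siegel" "\<And>i. d i > 0"
  shows "\<exists>c. x = (\<Sum>a\<in>UNIV. c a *\<^sub>R siegel_basis d \<tau> a)"
proof -
  have "x = (\<Sum>i\<in>UNIV. siegel_form \<tau> x (axis i 1) *\<^sub>R siegel_e \<tau> i - siegel_form \<tau> x (siegel_e \<tau> i) *\<^sub>R axis i 1)"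
    using siegel_symplectic_frame[OF assms(1)] unfolding symplectic_frame_def by blast
  also have "\<dots> = (\<Sum>a\<in>UNIV. case_sum (\<lambda>i. siegel_form \<tau> x (axis i 1))
      (\<lambda>i. - siegel_form \<tau> x (siegel_e \<tau> i) / d i) a *\<^sub>R siegel_basis d \<tau> a)"
    using assms(2) by (simp add: sum_UNIV_Plus siegel_basis_def sum_subtractf sum_negf)
  finally show ?thesis by blast
qed

lemma Siegel_lattice_cobounded:
  assumes "\<tau> \<in> Siegel" "\<And>i. d i > 0"
  shows "cobounded (Siegel_lattice d \<tau>)"
proof (rule coboundedI[where I = UNIV and u = "siegel_basis d \<tau>"])
  show "(\<Sum>a\<in>UNIV. of_int (k a) *\<^sub>R siegel_basis d \<tau> a) \<in> Siegel_lattice d \<tau>" for k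
    unfolding Siegel_lattice_eq by blast
qed (rule siegel_basis_expansion[OF assms])

lemma siegel_p_lattice:
  assumes "\<tau> \<in> Siegel" "x \<in> Siegel_lattice d \<tau>"
  shows "siegel_p \<tau> x $ i \<in> \<int>"
proof -
  obtain k :: "_ \<Rightarrow> int" where x: "x = (\<Sum>a\<in>UNIV. of_int (k a) *\<^sub>R siegel_basis d \<tau> a)"
    using assms(2) unfolding Siegel_lattice_eq by blast
  have "siegel_p \<tau> (axis m 1) = 0" for m
    using siegel_p_eqI[OF assms(1), of "axis m 1" 0] by simp
  then have "siegel_p \<tau> x = (\<Sum>m\<in>UNIV. of_int (k (Inl m)) *\<^sub>R axis m 1)"
    by (simp add: x sum_UNIV_Plus siegel_basis_def linear_add[OF linear_siegel_p] linear_sum[OF linear_siegel_p]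
        linear_scale[OF linear_siegel_p] siegel_p_e[OF assms(1)])
  then show ?thesis by (auto simp: axis_def intro!: Ints_sum)
qed

section \<open>The Rosati trace form\<close>

lemma bilinear_sum_left: "bilinear b \<Longrightarrow> b (sum f I) y = (\<Sum>i\<in>I. b (f i) y)"
  unfolding bilinear_def using linear_sum[of "\<lambda>x. b x y" f I] by simp

lemma bilinear_sum_right: "bilinear b \<Longrightarrow> b x (sum f I) = (\<Sum>i\<in>I. b x (f i))"
  unfolding bilinear_def using linear_sum[of "b x" f I] by simp

text \<open>Contraction of a bilinear form with the bivector \<open>\<Sum>i. e i \<otimes> f i - f i \<otimes> e i\<close> inverse to a
  symplectic form with symplectic frame \<open>(e, f)\<close>.\<close>

definition contraction :: "('i::finite \<Rightarrow> 'a) \<Rightarrow> ('i \<Rightarrow> 'a) \<Rightarrow> ('a \<Rightarrow> 'a \<Rightarrow> real) \<Rightarrow> real" where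
  "contraction e f \<beta> = (\<Sum>i\<in>UNIV. \<beta> (e i) (f i) - \<beta> (f i) (e i))"

text \<open>The bivector inverse to E is the same for all frames: expand the first arguments in the
  primed frame, exchange the sums, and recognise each inner sum as the expansion of a primed vector
  in the unprimed frame.\<close>

lemma contraction_frame_independent:
  assumes b: "bilinear \<beta>" and E: "bilinear E" "\<And>x y. E y x = - E x y"
    and frames: "symplectic_frame E e f" "symplectic_frame E e' f'"
  shows "contraction e f \<beta> = contraction e' f' \<beta>"
proof -
  have exp: "\<beta> x y = (\<Sum>m\<in>UNIV. E x (f' m) * \<beta> (e' m) y - E x (e' m) * \<beta> (f' m) y)" for x y
  proof -
    have "\<beta> x y = \<beta> (\<Sum>i\<in>UNIV. E x (f' i) *\<^sub>R e' i - E x (e' i) *\<^sub>R f' i) y"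
      using frames(2) unfolding symplectic_frame_def by metis
    then show ?thesis
      by (simp add: bilinear_sum_left[OF b] bilinear_lsub[OF b] bilinear_lmul[OF b])
  qed
  \<comment> \<open>The expansion of y in the unprimed frame, with y moved to the second slot of E
    by antisymmetry so that the signs match those of the double sum below.\<close>
  have rev: "(\<Sum>i\<in>UNIV. E (e i) y * \<beta> z (f i) - E (f i) y * \<beta> z (e i)) = \<beta> z y" for y z
  proof -
    have "\<beta> z y = \<beta> z (\<Sum>i\<in>UNIV. E y (f i) *\<^sub>R e i - E y (e i) *\<^sub>R f i)"
      using frames(1) unfolding symplectic_frame_def by metis
    also have "\<dots> = (\<Sum>i\<in>UNIV. E y (f i) * \<beta> z (e i) - E y (e i) * \<beta> z (f i))"
      by (simp add: bilinear_sum_right[OF b] bilinear_rsub[OF b] bilinear_rmul[OF b])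
    also have "\<dots> = (\<Sum>i\<in>UNIV. E (e i) y * \<beta> z (f i) - E (f i) y * \<beta> z (e i))"
      by (rule sum.cong) (auto simp: E(2)[of y])
    finally show ?thesis by simp
  qed
  have "contraction e f \<beta> = (\<Sum>i\<in>UNIV.
      (\<Sum>m\<in>UNIV. E (e i) (f' m) * \<beta> (e' m) (f i) - E (e i) (e' m) * \<beta> (f' m) (f i)) -
      (\<Sum>m\<in>UNIV. E (f i) (f' m) * \<beta> (e' m) (e i) - E (f i) (e' m) * \<beta> (f' m) (e i)))"
    unfolding contraction_def by (intro sum.cong arg_cong2[of _ _ _ _ minus] refl exp)
  also have "\<dots> = (\<Sum>i\<in>UNIV. \<Sum>m\<in>UNIV.
      (E (e i) (f' m) * \<beta> (e' m) (f i) - E (f i) (f' m) * \<beta> (e' m) (e i)) -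
      (E (e i) (e' m) * \<beta> (f' m) (f i) - E (f i) (e' m) * \<beta> (f' m) (e i)))"
    by (simp add: sum_subtractf sum.distrib algebra_simps)
  also have "\<dots> = (\<Sum>m\<in>UNIV. \<Sum>i\<in>UNIV.
      (E (e i) (f' m) * \<beta> (e' m) (f i) - E (f i) (f' m) * \<beta> (e' m) (e i)) -
      (E (e i) (e' m) * \<beta> (f' m) (f i) - E (f i) (e' m) * \<beta> (f' m) (e i)))"
    by (rule sum.swap)
  also have "\<dots> = (\<Sum>m\<in>UNIV. \<beta> (e' m) (f' m) - \<beta> (f' m) (e' m))"
  proof (rule sum.cong[OF refl])
    fix m
    show "(\<Sum>i\<in>UNIV. (E (e i) (f' m) * \<beta> (e' m) (f i) - E (f i) (f' m) * \<beta> (e' m) (e i)) -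
      (E (e i) (e' m) * \<beta> (f' m) (f i) - E (f i) (e' m) * \<beta> (f' m) (e i))) =
      \<beta> (e' m) (f' m) - \<beta> (f' m) (e' m)"
      using rev[of "f' m" "e' m"] rev[of "e' m" "f' m"] by (simp add: sum_subtractf)
  qed
  finally show ?thesis by (simp add: contraction_def)
qed

text \<open>Up to sign the trace of \<open>B\<^sup>\<dagger> B\<close>, where \<open>b\<close> is given by \<open>B\<close> relative to the symplectic form and \<open>\<dagger>\<close> is
  the Rosati involution.\<close>

definition rosati_norm :: "('i::finite \<Rightarrow> 'a) \<Rightarrow> ('i \<Rightarrow> 'a) \<Rightarrow> ('a \<Rightarrow> 'a \<Rightarrow> real) \<Rightarrow> real" where
  "rosati_norm e f b = contraction e f (\<lambda>x y. contraction e f (\<lambda>z w. b x z * b y w))"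

lemma bilinear_mult_fixed:
  assumes "bilinear (b :: _ \<Rightarrow> _ \<Rightarrow> real)"
  shows "bilinear (\<lambda>z w. b x z * b y w)" "bilinear (\<lambda>x y. b x z * b y w)"
  unfolding bilinear_def
  by (auto intro!: linearI simp: bilinear_ladd[OF assms] bilinear_radd[OF assms] bilinear_lmul[OF assms]
      bilinear_rmul[OF assms] algebra_simps)

lemma bilinear_contraction:
  assumes "bilinear (b :: _ \<Rightarrow> _ \<Rightarrow> real)"
  shows "bilinear (\<lambda>x y. contraction e f (\<lambda>z w. b x z * b y w))"
  unfolding bilinear_def contraction_def
  by (auto intro!: linearI simp: bilinear_ladd[OF assms] bilinear_radd[OF assms] bilinear_lmul[OF assms]
      bilinear_rmul[OF assms] algebra_simps sum.distrib sum_distrib_left sum_subtractf)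

lemma rosati_norm_frame_independent:
  assumes b: "bilinear b" and E: "bilinear E" "\<And>x y. E y x = - E x y"
    and frames: "symplectic_frame E e f" "symplectic_frame E e' f'"
  shows "rosati_norm e f b = rosati_norm e' f' b"
proof -
  have "contraction e f (\<lambda>z w. b x z * b y w) = contraction e' f' (\<lambda>z w. b x z * b y w)" for x y
    by (rule contraction_frame_independent[OF bilinear_mult_fixed(1)[OF b] E frames])
  then show ?thesis
    unfolding rosati_norm_def
    using contraction_frame_independent[OF bilinear_contraction[OF b] E frames, of e' f'] by simp
qed

lemma rosati_norm_explicit:
  "rosati_norm e f b = 2 * (\<Sum>i\<in>UNIV. \<Sum>j\<in>UNIV. b (e i) (e j) * b (f i) (f j) - b (e i) (f j) * b (f i) (e j))"
  unfolding rosati_norm_def contraction_def sum_distrib_left sum_subtractf[symmetric]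
  by (intro sum.cong refl) (simp add: algebra_simps)

text \<open>For e = i w and f = w, invariance under i gives b (i x) y = - b x (i y), so both
  products in the explicit formula become squares. This is the positivity of the Rosati involution,
  for b not necessarily alternating.\<close>

lemma rosati_norm_unitary:
  assumes "bilinear b" "\<And>x y. b (\<i> *s x) (\<i> *s y) = b x y"
  shows "rosati_norm (\<lambda>k. \<i> *s w k) w b = 2 * (\<Sum>k\<in>UNIV. \<Sum>l\<in>UNIV. (b (w k) (w l))\<^sup>2 + (b (w k) (\<i> *s w l))\<^sup>2)"
proof -
  have "b (\<i> *s x) y = - b x (\<i> *s y)" for x y
    using assms(2)[of "\<i> *s x" y] by (simp add: vsmult_i_i bilinear_lneg[OF assms(1)])
  then show ?thesis by (simp add: rosati_norm_explicit assms(2) power2_eq_square vsmult_i_i bilinear_rneg[OF assms(1)])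
qed

text \<open>Cholesky decomposition by induction on a set A that supports g. If \<open>g a a\<close>
  is nonzero, a matrix of rank one is split off and the Schur complement remains; if it is zero,
  semidefiniteness forces column a to vanish.\<close>

lemma psd_sum_of_squares_aux:
  fixes g :: "'n::finite \<Rightarrow> 'n \<Rightarrow> real"
  assumes "finite A" "\<And>i j. g i j = g j i" "\<And>x. (\<Sum>i\<in>UNIV. \<Sum>j\<in>UNIV. x i * g i j * x j) \<ge> 0"
    and "\<And>i j. i \<notin> A \<Longrightarrow> g i j = 0"
  shows "\<exists>w :: 'n \<Rightarrow> 'n \<Rightarrow> real. \<forall>i j. g i j = (\<Sum>k\<in>A. w k i * w k j)"
  using assms
proof (induction A arbitrary: g rule: finite_induct)
  case empty
  then show ?case by simp
next
  case (insert a A)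
  \<comment> \<open>The quadratic form at x + t e_a, with e_a the unit vector of a; both cases below
    evaluate it at a suitable t.\<close>
  have quad_add: "(\<Sum>i\<in>UNIV. \<Sum>j\<in>UNIV. (x i + t * of_bool (i = a)) * g i j * (x j + t * of_bool (j = a))) =
    (\<Sum>i\<in>UNIV. \<Sum>j\<in>UNIV. x i * g i j * x j) + 2 * t * (\<Sum>i\<in>UNIV. x i * g i a) + t\<^sup>2 * g a a" for x t
  proof -
    define q where "q x y = (\<Sum>i\<in>UNIV. \<Sum>j\<in>UNIV. x i * g i j * y j)" for x y :: "'n \<Rightarrow> real"
    define \<delta> where "\<delta> i = (if i = a then 1 else 0 :: real)" for i
    have delta: "q y \<delta> = (\<Sum>i\<in>UNIV. y i * g i a)" for y
      by (simp add: q_def \<delta>_def if_distrib[of "(*) _"] cong: if_cong)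
    have "q \<delta> x = q x \<delta>"
      unfolding q_def by (subst sum.swap) (simp add: insert.prems(1) mult_ac)
    moreover have "q \<delta> \<delta> = g a a"
      unfolding delta by (simp add: \<delta>_def if_distrib[of "\<lambda>x. x * _"] cong: if_cong)
    moreover have "(\<Sum>i\<in>UNIV. \<Sum>j\<in>UNIV. (x i + t * \<delta> i) * g i j * (x j + t * \<delta> j)) =
      q x x + t * q x \<delta> + t * q \<delta> x + t\<^sup>2 * q \<delta> \<delta>"
      by (simp add: q_def algebra_simps sum.distrib sum_distrib_left power2_eq_square)
    moreover have "\<delta> = (\<lambda>i. of_bool (i = a))" by (simp add: \<delta>_def fun_eq_iff)
    ultimately show ?thesis by (simp add: delta q_def)
  qed
  show ?case
  proof (cases "g a a = 0")
    case True
    have col: "g i a = 0" for i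
    proof (rule ccontr)
      assume nz: "g i a \<noteq> 0"
      define C where "C = (\<Sum>k\<in>UNIV. \<Sum>j\<in>UNIV. of_bool (k = i) * g k j * of_bool (j = i))"
      have "(\<Sum>k\<in>UNIV. of_bool (k = i) * g k a) = g i a"
        by (simp add: of_bool_def if_distrib[of "\<lambda>x. x * _"] cong: if_cong)
      then have "0 \<le> C + 2 * t * g i a" for t
        using insert.prems(2)[of "\<lambda>k. of_bool (k = i) + t * of_bool (k = a)"]
        unfolding quad_add[of "\<lambda>k. of_bool (k = i)" t] C_def[symmetric] True by simp
      \<comment> \<open>This t makes the right-hand side equal to -1.\<close>
      from this[of "- (C + 1) / (2 * g i a)"] show False using nz by (simp add: field_simps)
    qed
    have "i \<notin> A \<Longrightarrow> g i j = 0" for i j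
      using insert.prems(1)[of a j] insert.prems(3)[of i j] col by (cases "i = a") auto
    then obtain w :: "'n \<Rightarrow> 'n \<Rightarrow> real" where w: "\<forall>i j. g i j = (\<Sum>k\<in>A. w k i * w k j)"
      using insert.IH[of g] insert.prems by blast
    have "g i j = (\<Sum>k\<in>insert a A. (w(a := \<lambda>_. 0)) k i * (w(a := \<lambda>_. 0)) k j)" for i j
    proof -
      have "(\<Sum>k\<in>A. (w(a := \<lambda>_. 0)) k i * (w(a := \<lambda>_. 0)) k j) = (\<Sum>k\<in>A. w k i * w k j)"
        using insert.hyps by (intro sum.cong) auto
      then show ?thesis using w insert.hyps by simp
    qed
    then show ?thesis by blast
  next
    case False
    have "(\<Sum>k\<in>UNIV. \<Sum>j\<in>UNIV. of_bool (k = a) * g k j * of_bool (j = a)) = g a a"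
      by (simp add: of_bool_def if_distrib[of "\<lambda>x. x * _"] if_distrib[of "(*) _"] cong: if_cong)
    then have pos: "g a a > 0"
      using False insert.prems(2)[of "\<lambda>k. of_bool (k = a)"] by simp
    define g' where "g' i j = g i j - g i a * g j a / g a a" for i j
    have "(\<Sum>i\<in>UNIV. \<Sum>j\<in>UNIV. x i * g' i j * x j) \<ge> 0" for x
    proof -
      let ?s = "\<Sum>i\<in>UNIV. x i * g i a"
      have "(\<Sum>i\<in>UNIV. \<Sum>j\<in>UNIV. x i * g' i j * x j) =
        (\<Sum>i\<in>UNIV. \<Sum>j\<in>UNIV. x i * g i j * x j) - (\<Sum>i\<in>UNIV. \<Sum>j\<in>UNIV. (x i * g i a) * (x j * g j a)) / g a a"
        by (simp add: g'_def algebra_simps sum_subtractf sum_divide_distrib)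
      also have "(\<Sum>i\<in>UNIV. \<Sum>j\<in>UNIV. (x i * g i a) * (x j * g j a)) = ?s * ?s"
        by (simp add: sum_product)
      \<comment> \<open>Completing the square: t = - \<open>?s / g a a\<close> minimises the
        expression in \<open>quad_add\<close>, and the minimum is the value of the Schur
        complement.\<close>
      also have "(\<Sum>i\<in>UNIV. \<Sum>j\<in>UNIV. x i * g i j * x j) - ?s * ?s / g a a =
        (\<Sum>i\<in>UNIV. \<Sum>j\<in>UNIV. x i * g i j * x j) + 2 * (- ?s / g a a) * ?s + (- ?s / g a a)\<^sup>2 * g a a"
        using pos by (simp add: power2_eq_square)
      also have "\<dots> \<ge> 0"
        unfolding quad_add[symmetric] by (rule insert.prems(2))
      finally show ?thesis .
    qed
    moreover have "g' i j = g' j i" for i j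
      using insert.prems(1)[of i j] by (simp add: g'_def mult.commute)
    moreover have "g' i j = 0" if "i \<notin> A" for i j
      using that insert.prems(3) insert.prems(1)[of j a] pos by (cases "i = a") (auto simp: g'_def)
    ultimately obtain w :: "'n \<Rightarrow> 'n \<Rightarrow> real" where w: "\<forall>i j. g' i j = (\<Sum>k\<in>A. w k i * w k j)"
      using insert.IH[of g'] by blast
    let ?w = "w(a := \<lambda>i. g i a / sqrt (g a a))"
    have "g i j = (\<Sum>k\<in>insert a A. ?w k i * ?w k j)" for i j
    proof -
      have "(\<Sum>k\<in>A. ?w k i * ?w k j) = g' i j"
        using insert.hyps w by (simp add: fun_upd_def) (intro sum.cong, auto)
      then show ?thesis using insert.hyps pos by (simp add: g'_def)
    qed
    then show ?thesis by blast
  qed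
qed

text \<open>Y is the sum of the rank one matrices w_k w_k^T, with as many vectors as the dimension.
  For Y = Im \<tau> these vectors yield the unitary frame.\<close>

lemma psd_sum_of_squares:
  fixes Y :: "real^'n^'n"
  assumes "transpose Y = Y" "\<And>x. x \<bullet> (Y *v x) \<ge> 0"
  obtains w :: "'n \<Rightarrow> real^'n" where "\<And>z. Y *v z = (\<Sum>k\<in>UNIV. (z \<bullet> w k) *\<^sub>R w k)"
proof -
  have "Y $ i $ j = Y $ j $ i" for i j
    using assms(1) by (metis transpose_def vec_lambda_beta)
  moreover have "(\<Sum>i\<in>UNIV. \<Sum>j\<in>UNIV. x i * Y $ i $ j * x j) \<ge> 0" for x :: "'n \<Rightarrow> real"
    using assms(2)[of "\<chi> i. x i"] by (simp add: inner_vec_def matrix_vector_mult_def sum_distrib_left mult.assoc)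
  ultimately obtain w :: "'n \<Rightarrow> 'n \<Rightarrow> real" where w: "\<And>i j. Y $ i $ j = (\<Sum>k\<in>UNIV. w k i * w k j)"
    using psd_sum_of_squares_aux[of UNIV "\<lambda>i j. Y $ i $ j"] by auto
  have "Y *v z = (\<Sum>k\<in>UNIV. (z \<bullet> (\<chi> i. w k i)) *\<^sub>R (\<chi> i. w k i))" for z
  proof -
    have "(Y *v z) $ i = (\<Sum>k\<in>UNIV. (z \<bullet> (\<chi> i. w k i)) * w k i)" for i
      by (simp add: matrix_vector_mult_def w inner_vec_def sum_distrib_left sum_distrib_right mult_ac) (rule sum.swap)
    then show ?thesis by (simp add: vec_eq_iff)
  qed
  then show ?thesis by (rule that)
qed

section \<open>Forms of type (1,1)\<close>

definition hodge :: "(complex^'n \<Rightarrow> complex^'n \<Rightarrow> real) \<Rightarrow> bool" where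
  "hodge b \<longleftrightarrow> (\<forall>x y. b (\<i> *s x) (\<i> *s y) = b x y)"

text \<open>The symplectic frame without the weights d, of which \<open>siegel_basis\<close> is a
  rescaling. In this frame the matrix of the Riemann form does not depend on d.\<close>

definition siegel_frame :: "complex^'n^'n \<Rightarrow> 'n + 'n \<Rightarrow> complex^'n" where
  "siegel_frame \<tau> = case_sum (siegel_e \<tau>) (\<lambda>i. axis i 1)"

definition siegel_coord :: "complex^'n^'n \<Rightarrow> complex^'n \<Rightarrow> 'n + 'n \<Rightarrow> real" where
  "siegel_coord \<tau> x = case_sum (\<lambda>i. siegel_form \<tau> x (axis i 1)) (\<lambda>i. - siegel_form \<tau> x (siegel_e \<tau> i))"

text \<open>One matrix N defines a form at every \<tau>: this keeps a class constant while the
  complex structure varies. It inverts \<open>gram\<close> at each \<tau> in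
  \<open>Siegel\<close>.\<close>

definition form_of :: "('n + 'n \<Rightarrow> 'n + 'n \<Rightarrow> real) \<Rightarrow> complex^'n^'n \<Rightarrow> complex^'n \<Rightarrow> complex^'n \<Rightarrow> real" where
  "form_of N \<tau> x y = (\<Sum>a\<in>UNIV. \<Sum>c\<in>UNIV. siegel_coord \<tau> x a * siegel_coord \<tau> y c * N a c)"

definition gram :: "(complex^'n \<Rightarrow> complex^'n \<Rightarrow> real) \<Rightarrow> complex^'n^'n \<Rightarrow> 'n + 'n \<Rightarrow> 'n + 'n \<Rightarrow> real" where
  "gram b \<tau> a c = b (siegel_frame \<tau> a) (siegel_frame \<tau> c)"

text \<open>\<open>form_of N \<tau>\<close>, extended complex bilinearly, evaluated at the vectors \<open>e\<^sub>i - \<Sum>m. \<tau>\<^sub>m\<^sub>i f\<^sub>m\<close>, which span the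
  kernel \<open>V\<^sup>0\<^sup>,\<^sup>1\<close> of the complexification of V onto V. It vanishes there iff the form has type (1,1).\<close>

definition hodge_eq :: "('n + 'n \<Rightarrow> 'n + 'n \<Rightarrow> real) \<Rightarrow> 'n \<Rightarrow> 'n \<Rightarrow> complex^'n^'n \<Rightarrow> complex" where
  "hodge_eq N i j \<tau> = of_real (N (Inl i) (Inl j)) - (\<Sum>m\<in>UNIV. \<tau> $ m $ j * of_real (N (Inl i) (Inr m)))
     - (\<Sum>m\<in>UNIV. \<tau> $ m $ i * of_real (N (Inr m) (Inl j)))
     + (\<Sum>m\<in>UNIV. \<Sum>l\<in>UNIV. \<tau> $ m $ i * \<tau> $ l $ j * of_real (N (Inr m) (Inr l)))"

lemma linear_siegel_coord: "linear (\<lambda>x. siegel_coord \<tau> x a)"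
proof -
  have "linear (\<lambda>x. siegel_form \<tau> x y)" for y
    using bilinear_siegel_form[of \<tau>] unfolding bilinear_def by blast
  then show ?thesis
    by (cases a) (simp_all add: siegel_coord_def linear_compose_neg)
qed

lemma siegel_coord_expansion:
  assumes "\<tau> \<in> Siegel"
  shows "x = (\<Sum>a\<in>UNIV. siegel_coord \<tau> x a *\<^sub>R siegel_frame \<tau> a)"
proof -
  have "x = (\<Sum>i\<in>UNIV. siegel_form \<tau> x (axis i 1) *\<^sub>R siegel_e \<tau> i - siegel_form \<tau> x (siegel_e \<tau> i) *\<^sub>R axis i 1)"
    using siegel_symplectic_frame[OF assms(1)] unfolding symplectic_frame_def by blast
  then show ?thesis
    by (simp add: sum_UNIV_Plus siegel_frame_def siegel_coord_def sum_subtractf sum_negf)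
qed

lemma siegel_p_f: "\<tau> \<in> Siegel \<Longrightarrow> siegel_p \<tau> (axis m 1) = 0"
  by (rule siegel_p_eqI) auto

definition standard_symplectic :: "'n + 'n \<Rightarrow> 'n + 'n \<Rightarrow> real" where
  "standard_symplectic a c = case_sum (\<lambda>i. case_sum (\<lambda>j. 0) (\<lambda>j. of_bool (i = j)) c)
     (\<lambda>i. case_sum (\<lambda>j. - of_bool (i = j)) (\<lambda>j. 0) c) a"

lemma siegel_e_nth: "siegel_e \<tau> i $ m = \<tau> $ m $ i"
  by (simp add: siegel_e_def)

lemma gram_siegel_form:
  assumes "\<tau> \<in> Siegel"
  shows "gram (siegel_form \<tau>) \<tau> = standard_symplectic"
proof -
  have "gram (siegel_form \<tau>) \<tau> a c = standard_symplectic a c" for a c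
    by (cases a; cases c)
      (simp_all add: gram_def standard_symplectic_def siegel_frame_def siegel_form_f siegel_form_e[OF assms]
        siegel_p_e[OF assms] siegel_p_f[OF assms] axis_1_nth inner_axis' vec_Re_def siegel_e_nth
        Siegel_sym[OF assms, of _ _] if_distrib[of Re] cong: if_cong)
  then show ?thesis by blast
qed

lemma siegel_coord_frame:
  assumes "\<tau> \<in> Siegel"
  shows "siegel_coord \<tau> (siegel_frame \<tau> a) c = of_bool (a = c)"
proof -
  have g: "siegel_form \<tau> (siegel_frame \<tau> a) (siegel_frame \<tau> c) = standard_symplectic a c" for a c
    using gram_siegel_form[OF assms] by (simp add: gram_def fun_eq_iff)
  show ?thesis
    \<comment> \<open>The coordinate at c is, up to sign, the pairing with the partner of c, whose
      index has \<open>Inl\<close> and \<open>Inr\<close> exchanged.\<close>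
    using g[of a "Inl (projr c)"] g[of a "Inr (projl c)"]
    by (cases a; cases c) (simp_all add: siegel_coord_def siegel_frame_def standard_symplectic_def)
qed

lemma bilinear_form_of: "bilinear (form_of N \<tau>)"
  unfolding bilinear_def form_of_def
  by (auto intro!: linearI simp: linear_add[OF linear_siegel_coord] linear_scale[OF linear_siegel_coord]
      algebra_simps sum.distrib sum_distrib_left)

lemma form_of_gram:
  assumes "\<tau> \<in> Siegel" "bilinear b"
  shows "form_of (gram b \<tau>) \<tau> x y = b x y"
proof -
  have "b x y = b (\<Sum>a\<in>UNIV. siegel_coord \<tau> x a *\<^sub>R siegel_frame \<tau> a) (\<Sum>a\<in>UNIV. siegel_coord \<tau> y a *\<^sub>R siegel_frame \<tau> a)"
    using siegel_coord_expansion[OF assms(1)] by metis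
  then show ?thesis
    by (simp add: bilinear_sum_left[OF assms(2)] bilinear_sum_right[OF assms(2)] bilinear_lmul[OF assms(2)]
        bilinear_rmul[OF assms(2)] form_of_def gram_def sum_distrib_left mult_ac) (rule sum.swap)
qed

lemma gram_form_of:
  assumes "\<tau> \<in> Siegel"
  shows "gram (form_of N \<tau>) \<tau> = N"
proof -
  have "gram (form_of N \<tau>) \<tau> a c = N a c" for a c
    by (simp add: gram_def form_of_def siegel_coord_frame[OF assms] of_bool_def
        if_distrib[of "\<lambda>x. x * _"] if_distrib[of "(*) _"] cong: if_cong)
  then show ?thesis by blast
qed

text \<open>Let y_i be the imaginary part of column i of \<tau>, and write I for the scalar of the
  complexification. The vector e_i minus the combination of the f_m with coefficients from column i
  is i y_i - I y_i. Hence the real and imaginary parts of \<open>hodge_eq\<close> measure the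
  failure of invariance under i on the y_i, and the vectors y_i, i y_i span V because Im \<tau> is
  invertible.\<close>

lemma hodge_iff_hodge_eq:
  fixes \<tau> :: "complex^'n^'n"
  assumes \<tau>: "\<tau> \<in> Siegel" and b: "bilinear b"
  shows "hodge b \<longleftrightarrow> (\<forall>i j. hodge_eq (gram b \<tau>) i j \<tau> = 0)"
proof -
  define y where "y i = (\<Sum>m\<in>UNIV. Im (\<tau> $ m $ i) *\<^sub>R (axis m 1 :: complex^'n))" for i
  have iy: "\<i> *s y i = siegel_e \<tau> i - (\<Sum>m\<in>UNIV. Re (\<tau> $ m $ i) *\<^sub>R axis m 1)" for i
    by (simp add: vec_eq_iff y_def siegel_e_def axis_1_nth scaleR_conv_of_real[where 'a = complex]
        if_distrib[of "(*) _"] complex_eq_iff cong: if_cong)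
  note bl = bilinear_sum_left[OF b] bilinear_sum_right[OF b] bilinear_lmul[OF b] bilinear_rmul[OF b]
    bilinear_lsub[OF b] bilinear_rsub[OF b]
  have Re: "Re (hodge_eq (gram b \<tau>) i j \<tau>) = b (\<i> *s y i) (\<i> *s y j) - b (y i) (y j)" for i j
    unfolding iy unfolding y_def bilinear_lsub[OF b] bilinear_rsub[OF b]
    unfolding bilinear_sum_left[OF b] unfolding bilinear_sum_right[OF b] bilinear_lmul[OF b] bilinear_rmul[OF b]
    by (simp add: hodge_eq_def gram_def siegel_frame_def algebra_simps sum_subtractf
        sum_distrib_left sum_distrib_right sum.distrib)
  have Im: "Im (hodge_eq (gram b \<tau>) i j \<tau>) = - b (\<i> *s y i) (y j) - b (y i) (\<i> *s y j)" for i j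
    unfolding iy unfolding y_def bilinear_lsub[OF b] bilinear_rsub[OF b]
    unfolding bilinear_sum_left[OF b] unfolding bilinear_sum_right[OF b] bilinear_lmul[OF b] bilinear_rmul[OF b]
    by (simp add: hodge_eq_def gram_def siegel_frame_def algebra_simps sum_subtractf
        sum_distrib_left sum_distrib_right sum.distrib)
  show ?thesis
  proof
    assume "hodge b"
    then have h: "b (\<i> *s x) (\<i> *s z) = b x z" for x z by (simp add: hodge_def)
    have "b (\<i> *s x) z = - b x (\<i> *s z)" for x z
      using h[of "\<i> *s x" z] by (simp add: vsmult_i_i bilinear_lneg[OF b])
    with h show "\<forall>i j. hodge_eq (gram b \<tau>) i j \<tau> = 0"
      by (simp add: complex_eq_iff Re Im)
  next
    assume z: "\<forall>i j. hodge_eq (gram b \<tau>) i j \<tau> = 0"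
    have eq: "b (\<i> *s y i) (\<i> *s y j) = b (y i) (y j)" "b (\<i> *s y i) (y j) = - b (y i) (\<i> *s y j)" for i j
      using Re[of i j] Im[of i j] z by simp_all
    define S where "S = range y \<union> range (\<lambda>i. \<i> *s y i)"
    have S: "x \<in> span S" for x
    proof -
      let ?r = "siegel_p \<tau> (\<i> *s x)" and ?p = "siegel_p \<tau> x"
      have p: "(\<Sum>i\<in>UNIV. siegel_p \<tau> v $ i * Im (\<tau> $ m $ i)) = vec_Im v $ m" for v m
        using arg_cong[OF Im_mat_siegel_p[OF \<tau>, of v], of "\<lambda>u. u $ m"]
        by (simp add: matrix_vector_mult_def Im_mat_def mult.commute)
      \<comment> \<open>Im \<tau> sends \<open>?p\<close> to the imaginary part of x and
        \<open>?r\<close> to that of i x, which is the real part of x.\<close>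
      have "x = (\<Sum>i\<in>UNIV. ?r $ i *\<^sub>R y i) + (\<Sum>i\<in>UNIV. ?p $ i *\<^sub>R (\<i> *s y i))"
        using p[of "\<i> *s x"] p[of x]
        by (simp add: vec_eq_iff y_def axis_1_nth complex_eq_iff if_distrib[of "(*) _"] if_distrib[of Re] if_distrib[of Im]
            vec_Im_def cong: if_cong)
      also have "\<dots> \<in> span S"
        by (intro span_add span_sum span_scale span_base) (auto simp: S_def)
      finally show ?thesis .
    qed
    have bi: "bilinear (\<lambda>x y. b (\<i> *s x) (\<i> *s y))"
      unfolding bilinear_def
      by (auto intro!: linearI simp: vsmult_add vsmult_scaleR bilinear_ladd[OF b] bilinear_radd[OF b] bl)
    have on_S: "b (\<i> *s u) (\<i> *s v) = b u v" if "u \<in> S" "v \<in> S" for u v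
      using that by (auto simp: S_def eq vsmult_i_i bilinear_lneg[OF b] bilinear_rneg[OF b])
    have "b (\<i> *s u) (\<i> *s v) = b u v" for u v
      using bilinear_eq[OF bi b, of UNIV S UNIV S] S on_S by blast
    then show "hodge b" by (simp add: hodge_def)
  qed
qed

section \<open>Integral forms and the Hodge loci\<close>

definition siegel_weight :: "('n \<Rightarrow> nat) \<Rightarrow> 'n + 'n \<Rightarrow> real" where
  "siegel_weight d = case_sum (\<lambda>_. 1) (\<lambda>i. real (d i))"

lemma siegel_basis_weight: "siegel_basis d \<tau> a = siegel_weight d a *\<^sub>R siegel_frame \<tau> a"
  by (simp add: siegel_basis_def siegel_weight_def siegel_frame_def split: sum.split)

lemma integral_on_lattice_iff:
  assumes "bilinear b"
  shows "(\<forall>x\<in>Siegel_lattice d \<tau>. \<forall>y\<in>Siegel_lattice d \<tau>. b x y \<in> \<int>) \<longleftrightarrow>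
    (\<forall>a c. siegel_weight d a * siegel_weight d c * gram b \<tau> a c \<in> \<int>)"
proof -
  have g: "b (siegel_basis d \<tau> a) (siegel_basis d \<tau> c) = siegel_weight d a * siegel_weight d c * gram b \<tau> a c" for a c
    by (simp add: siegel_basis_weight gram_def bilinear_lmul[OF assms] bilinear_rmul[OF assms])
  show ?thesis
  proof
    assume "\<forall>x\<in>Siegel_lattice d \<tau>. \<forall>y\<in>Siegel_lattice d \<tau>. b x y \<in> \<int>"
    then show "\<forall>a c. siegel_weight d a * siegel_weight d c * gram b \<tau> a c \<in> \<int>"
      using siegel_basis_in_lattice g by metis
  next
    assume int: "\<forall>a c. siegel_weight d a * siegel_weight d c * gram b \<tau> a c \<in> \<int>"
    show "\<forall>x\<in>Siegel_lattice d \<tau>. \<forall>y\<in>Siegel_lattice d \<tau>. b x y \<in> \<int>"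
    proof (intro ballI)
      fix x y assume "x \<in> Siegel_lattice d \<tau>" "y \<in> Siegel_lattice d \<tau>"
      then obtain k k' :: "_ \<Rightarrow> int" where
        "x = (\<Sum>a\<in>UNIV. of_int (k a) *\<^sub>R siegel_basis d \<tau> a)" "y = (\<Sum>a\<in>UNIV. of_int (k' a) *\<^sub>R siegel_basis d \<tau> a)"
        unfolding Siegel_lattice_eq by blast
      moreover have "b (siegel_basis d \<tau> a) (siegel_basis d \<tau> c) \<in> \<int>" for a c
        using int g by simp
      ultimately show "b x y \<in> \<int>"
        by (auto simp: bilinear_sum_left[OF assms] bilinear_sum_right[OF assms] bilinear_lmul[OF assms]
            bilinear_rmul[OF assms] intro!: Ints_sum Ints_mult)
    qed
  qed
qed

text \<open>Phrased through forms on V and not through matrices, so that it can be carried along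
  isomorphisms of tori.\<close>

definition hodge_locus :: "('n::finite \<Rightarrow> nat) \<Rightarrow> nat \<Rightarrow> (complex^'n^'n) set" where
  "hodge_locus d k = {\<tau> \<in> Siegel. \<exists>b. bilinear b \<and> hodge b \<and>
     (\<forall>x\<in>Siegel_lattice d \<tau>. \<forall>y\<in>Siegel_lattice d \<tau>. b x y \<in> \<int>) \<and>
     (\<nexists>q. \<forall>x y. b x y = q * siegel_form \<tau> x y) \<and>
     rosati_norm (siegel_e \<tau>) (\<lambda>i. axis i 1) b \<le> k}"

text \<open>The conditions on a form that do not involve \<tau>. In
  \<open>rosati_norm Inl Inr N\<close> the indices themselves serve as the frame and the matrix as
  the form.\<close>

definition admissible :: "('n::finite \<Rightarrow> nat) \<Rightarrow> nat \<Rightarrow> ('n + 'n \<Rightarrow> 'n + 'n \<Rightarrow> real) \<Rightarrow> bool" where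
  "admissible d k N \<longleftrightarrow> (\<forall>a c. siegel_weight d a * siegel_weight d c * N a c \<in> \<int>) \<and>
     (\<nexists>q. \<forall>a c. N a c = q * standard_symplectic a c) \<and> rosati_norm Inl Inr N \<le> k"

lemma rosati_norm_gram: "rosati_norm (siegel_e \<tau>) (\<lambda>i. axis i 1) b = rosati_norm Inl Inr (gram b \<tau>)"
  by (simp add: rosati_norm_explicit gram_def siegel_frame_def)

lemma multiple_of_siegel_form_iff:
  assumes "\<tau> \<in> Siegel" "bilinear b"
  shows "(\<forall>x y. b x y = q * siegel_form \<tau> x y) \<longleftrightarrow> (\<forall>a c. gram b \<tau> a c = q * standard_symplectic a c)"
proof
  assume "\<forall>x y. b x y = q * siegel_form \<tau> x y"
  then show "\<forall>a c. gram b \<tau> a c = q * standard_symplectic a c"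
    by (simp add: gram_siegel_form[OF assms(1), symmetric] gram_def)
next
  assume g: "\<forall>a c. gram b \<tau> a c = q * standard_symplectic a c"
  have "b x y = q * siegel_form \<tau> x y" for x y
    using form_of_gram[OF assms, of x y, symmetric] form_of_gram[OF assms(1) bilinear_siegel_form, of \<tau> x y, symmetric]
    by (simp add: gram_siegel_form[OF assms(1)] form_of_def g sum_distrib_left mult_ac)
  then show "\<forall>x y. b x y = q * siegel_form \<tau> x y" by blast
qed

text \<open>\<open>gram\<close> and \<open>form_of\<close> translate between forms at \<tau> and
  matrices. On the matrix side \<tau> enters only through the polynomial equations
  \<open>hodge_eq\<close>, which is what analyticity requires.\<close>

lemma hodge_locus_iff:
  "\<tau> \<in> hodge_locus d k \<longleftrightarrow> \<tau> \<in> Siegel \<and> (\<exists>N. admissible d k N \<and> (\<forall>i j. hodge_eq N i j \<tau> = 0))"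
proof (cases "\<tau> \<in> Siegel")
  case True
  show ?thesis
  proof
    assume "\<tau> \<in> hodge_locus d k"
    then obtain b where b: "bilinear b" "hodge b" "\<forall>x\<in>Siegel_lattice d \<tau>. \<forall>y\<in>Siegel_lattice d \<tau>. b x y \<in> \<int>"
      "\<nexists>q. \<forall>x y. b x y = q * siegel_form \<tau> x y" "rosati_norm (siegel_e \<tau>) (\<lambda>i. axis i 1) b \<le> k"
      unfolding hodge_locus_def by blast
    then have "admissible d k (gram b \<tau>)"
      unfolding admissible_def rosati_norm_gram multiple_of_siegel_form_iff[OF True b(1)]
        integral_on_lattice_iff[OF b(1)] by blast
    then show "\<tau> \<in> Siegel \<and> (\<exists>N. admissible d k N \<and> (\<forall>i j. hodge_eq N i j \<tau> = 0))"
      using hodge_iff_hodge_eq[OF True b(1)] b(2) True by blast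
  next
    assume "\<tau> \<in> Siegel \<and> (\<exists>N. admissible d k N \<and> (\<forall>i j. hodge_eq N i j \<tau> = 0))"
    then obtain N where N: "admissible d k N" "\<forall>i j. hodge_eq N i j \<tau> = 0" by blast
    let ?b = "form_of N \<tau>"
    have "bilinear ?b" by (rule bilinear_form_of)
    moreover have "hodge ?b"
      using hodge_iff_hodge_eq[OF True bilinear_form_of] N(2) by (simp add: gram_form_of[OF True])
    moreover have "\<forall>x\<in>Siegel_lattice d \<tau>. \<forall>y\<in>Siegel_lattice d \<tau>. ?b x y \<in> \<int>"
      using N(1) by (simp add: integral_on_lattice_iff[OF bilinear_form_of] gram_form_of[OF True] admissible_def)
    moreover have "\<nexists>q. \<forall>x y. ?b x y = q * siegel_form \<tau> x y"
      using N(1) unfolding multiple_of_siegel_form_iff[OF True bilinear_form_of] gram_form_of[OF True] admissible_def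
      by blast
    moreover have "rosati_norm (siegel_e \<tau>) (\<lambda>i. axis i 1) ?b \<le> k"
      using N(1) by (simp add: rosati_norm_gram gram_form_of[OF True] admissible_def)
    ultimately show "\<tau> \<in> hodge_locus d k"
      unfolding hodge_locus_def using True by blast
  qed
qed (simp add: hodge_locus_def)

section \<open>Local boundedness\<close>

definition complex_vec :: "real^'n \<Rightarrow> complex^'n" where
  "complex_vec r = (\<chi> i. of_real (r $ i))"

lemma vec_Re_complex_vec [simp]: "vec_Re (complex_vec r) = r"
  and vec_Im_complex_vec [simp]: "vec_Im (complex_vec r) = 0"
  by (simp_all add: vec_Re_def vec_Im_def complex_vec_def vec_eq_iff)

lemma siegel_form_complex_vec:
  assumes "\<tau> \<in> Siegel"
  shows "siegel_form \<tau> x (complex_vec r) = siegel_p \<tau> x \<bullet> r"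
    and "siegel_form \<tau> x (\<i> *s complex_vec r) = - siegel_p \<tau> (\<i> *s complex_vec r) \<bullet> vec_Re x"
proof -
  have "siegel_p \<tau> (complex_vec r) = 0" by (rule siegel_p_eqI[OF assms]) simp
  then show "siegel_form \<tau> x (complex_vec r) = siegel_p \<tau> x \<bullet> r"
    by (simp add: siegel_form_def)
qed (simp add: siegel_form_def)

text \<open>A frame that is unitary for the Hermitian form with imaginary part \<open>siegel_form \<tau>\<close>.\<close>

lemma unitary_frame:
  fixes \<tau> :: "complex^'n^'n"
  assumes "\<tau> \<in> Siegel" and w: "\<And>z. Im_mat \<tau> *v z = (\<Sum>k\<in>UNIV. (z \<bullet> w k) *\<^sub>R w k)"
  shows "symplectic_frame (siegel_form \<tau>) (\<lambda>k. \<i> *s complex_vec (w k)) (\<lambda>k. complex_vec (w k))"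
  unfolding symplectic_frame_def
proof
  fix x :: "complex^'n"
  let ?v = "\<lambda>k. complex_vec (w k)"
  \<comment> \<open>The real part of x is the imaginary part of i x, and symmetry of Im \<tau> moves
    the pairing over to \<open>siegel_p\<close> of i x.\<close>
  have "siegel_p \<tau> (\<i> *s ?v k) \<bullet> vec_Re x = siegel_p \<tau> (\<i> *s x) \<bullet> w k" for k
    using Im_mat_sym[OF assms(1), of "siegel_p \<tau> (\<i> *s ?v k)" "siegel_p \<tau> (\<i> *s x)"]
    by (simp add: Im_mat_siegel_p[OF assms(1)])
  then have "(\<Sum>k\<in>UNIV. siegel_form \<tau> x (?v k) *\<^sub>R (\<i> *s ?v k) - siegel_form \<tau> x (\<i> *s ?v k) *\<^sub>R ?v k) =
    (\<Sum>k\<in>UNIV. (siegel_p \<tau> x \<bullet> w k) *\<^sub>R (\<i> *s ?v k)) + (\<Sum>k\<in>UNIV. (siegel_p \<tau> (\<i> *s x) \<bullet> w k) *\<^sub>R ?v k)"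
    by (simp add: siegel_form_complex_vec[OF assms(1)] sum.distrib)
  also have "\<dots> = \<i> *s complex_vec (Im_mat \<tau> *v siegel_p \<tau> x) + complex_vec (Im_mat \<tau> *v siegel_p \<tau> (\<i> *s x))"
    unfolding w by (simp add: vec_eq_iff complex_vec_def scaleR_conv_of_real[where 'a = complex] sum_distrib_left mult_ac)
  also have "\<dots> = x"
    by (simp add: Im_mat_siegel_p[OF assms(1)] vec_eq_iff complex_vec_def vec_Im_def vec_Re_def complex_eq_iff)
  finally show "x = (\<Sum>k\<in>UNIV. siegel_form \<tau> x (?v k) *\<^sub>R (\<i> *s ?v k) - siegel_form \<tau> x (\<i> *s ?v k) *\<^sub>R ?v k)" ..
qed

text \<open>By positivity the trace bounds every entry of b on the unitary frame. Expanding x and y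
  gives four products for each pair of indices, each with two coefficients bounded by G.\<close>

lemma hodge_bound:
  fixes b :: "complex^'n \<Rightarrow> complex^'n \<Rightarrow> real" and w :: "'m::finite \<Rightarrow> complex^'n" and G K :: real
  assumes b: "bilinear b" "hodge b"
    and frame: "symplectic_frame E (\<lambda>k. \<i> *s w k) w"
    and K: "rosati_norm (\<lambda>k. \<i> *s w k) w b \<le> K"
    and x: "\<And>k. \<bar>E x (w k)\<bar> \<le> G" "\<And>k. \<bar>E x (\<i> *s w k)\<bar> \<le> G"
    and y: "\<And>k. \<bar>E y (w k)\<bar> \<le> G" "\<And>k. \<bar>E y (\<i> *s w k)\<bar> \<le> G"
  shows "\<bar>b x y\<bar> \<le> (real (CARD('m)))\<^sup>2 * (4 * (G\<^sup>2 * (K + 1)))"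
proof -
  have h: "b (\<i> *s u) (\<i> *s v) = b u v" for u v using b(2) by (simp add: hodge_def)
  have h': "b (\<i> *s u) v = - b u (\<i> *s v)" for u v
    using h[of "\<i> *s u" v] by (simp add: vsmult_i_i bilinear_lneg[OF b(1)])
  have "(b (w k) (w l))\<^sup>2 + (b (w k) (\<i> *s w l))\<^sup>2 \<le> K" for k l
  proof -
    have "(b (w k) (w l))\<^sup>2 + (b (w k) (\<i> *s w l))\<^sup>2 \<le> (\<Sum>l\<in>UNIV. (b (w k) (w l))\<^sup>2 + (b (w k) (\<i> *s w l))\<^sup>2)"
      by (rule member_le_sum) auto
    also have "\<dots> \<le> (\<Sum>k\<in>UNIV. \<Sum>l\<in>UNIV. (b (w k) (w l))\<^sup>2 + (b (w k) (\<i> *s w l))\<^sup>2)"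
      by (rule member_le_sum[of k UNIV "\<lambda>k. \<Sum>l\<in>UNIV. (b (w k) (w l))\<^sup>2 + (b (w k) (\<i> *s w l))\<^sup>2"])
        (auto intro!: sum_nonneg)
    finally have two: "2 * ((b (w k) (w l))\<^sup>2 + (b (w k) (\<i> *s w l))\<^sup>2) \<le> K"
      using K by (simp add: rosati_norm_unitary[OF b(1) h])
    have half: "s \<le> K" if "2 * s \<le> K" "s \<ge> 0" for s :: real using that by linarith
    show ?thesis by (rule half[OF two sum_power2_ge_zero])
  qed
  then have sq: "(b (w k) (w l))\<^sup>2 \<le> K" "(b (w k) (\<i> *s w l))\<^sup>2 \<le> K" for k l
    by (smt (verit) zero_le_power2)+
  have le: "\<bar>t\<bar> \<le> K + 1" if "t\<^sup>2 \<le> K" for t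
  proof -
    have "0 \<le> (\<bar>t\<bar> - 1)\<^sup>2 + t\<^sup>2" by simp
    then have "2 * \<bar>t\<bar> \<le> 2 * t\<^sup>2 + 1" by (simp add: power2_diff)
    then show ?thesis using that zero_le_power2[of t] by linarith
  qed
  have ww: "\<bar>b (w k) (w l)\<bar> \<le> K + 1" "\<bar>b (w k) (\<i> *s w l)\<bar> \<le> K + 1" for k l
    using le sq by blast+
  have prod_le: "\<bar>s * t * u\<bar> \<le> G\<^sup>2 * (K + 1)" if "\<bar>s\<bar> \<le> G" "\<bar>t\<bar> \<le> G" "\<bar>u\<bar> \<le> K + 1" for s t u
    using that unfolding abs_mult power2_eq_square by (intro mult_mono) auto
  have "b x y = b (\<Sum>k\<in>UNIV. E x (w k) *\<^sub>R (\<i> *s w k) - E x (\<i> *s w k) *\<^sub>R w k)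
      (\<Sum>k\<in>UNIV. E y (w k) *\<^sub>R (\<i> *s w k) - E y (\<i> *s w k) *\<^sub>R w k)"
    using frame unfolding symplectic_frame_def by metis
  also have "\<dots> = (\<Sum>k\<in>UNIV. \<Sum>l\<in>UNIV. E x (w k) * E y (w l) * b (w k) (w l) + E x (w k) * E y (\<i> *s w l) * b (w k) (\<i> *s w l)
     - E x (\<i> *s w k) * E y (w l) * b (w k) (\<i> *s w l) + E x (\<i> *s w k) * E y (\<i> *s w l) * b (w k) (w l))"
    unfolding bilinear_sum_left[OF b(1)] unfolding bilinear_sum_right[OF b(1)]
    by (intro sum.cong refl) (simp add: bilinear_lsub[OF b(1)] bilinear_rsub[OF b(1)] bilinear_lmul[OF b(1)]
        bilinear_rmul[OF b(1)] h h' vsmult_i_i bilinear_rneg[OF b(1)] algebra_simps)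
  finally have "\<bar>b x y\<bar> \<le> (\<Sum>k\<in>(UNIV::'m set). \<Sum>l\<in>(UNIV::'m set). 4 * (G\<^sup>2 * (K + 1)))"
  proof -
    assume eq: "b x y = (\<Sum>k\<in>UNIV. \<Sum>l\<in>UNIV. E x (w k) * E y (w l) * b (w k) (w l) + E x (w k) * E y (\<i> *s w l) * b (w k) (\<i> *s w l)
     - E x (\<i> *s w k) * E y (w l) * b (w k) (\<i> *s w l) + E x (\<i> *s w k) * E y (\<i> *s w l) * b (w k) (w l))"
    show ?thesis
      unfolding eq
    proof (rule order_trans[OF sum_abs sum_mono[OF order_trans[OF sum_abs sum_mono]]])
      fix k l
      show "\<bar>E x (w k) * E y (w l) * b (w k) (w l) + E x (w k) * E y (\<i> *s w l) * b (w k) (\<i> *s w l)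
        - E x (\<i> *s w k) * E y (w l) * b (w k) (\<i> *s w l) + E x (\<i> *s w k) * E y (\<i> *s w l) * b (w k) (w l)\<bar>
        \<le> 4 * (G\<^sup>2 * (K + 1))"
        using prod_le[OF x(1)[of k] y(1)[of l] ww(1)[of k l]] prod_le[OF x(1)[of k] y(2)[of l] ww(2)[of k l]]
          prod_le[OF x(2)[of k] y(1)[of l] ww(2)[of k l]] prod_le[OF x(2)[of k] y(2)[of l] ww(1)[of k l]]
        by linarith
    qed
  qed
  then show ?thesis by (simp add: power2_eq_square mult_ac)
qed

lemma norm_entry_le: "norm (\<tau> $ i $ j) \<le> norm (\<tau> :: complex^'n^'m)"
  using Finite_Cartesian_Product.norm_nth_le[of "\<tau> $ i" j] Finite_Cartesian_Product.norm_nth_le[of \<tau> i] by linarith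

lemma norm_le_card:
  fixes x :: "'a::real_normed_vector^'n" and c :: real
  assumes "\<And>i. norm (x $ i) \<le> c"
  shows "norm x \<le> CARD('n) * c"
proof -
  have "norm x \<le> (\<Sum>i\<in>UNIV. norm (x $ i))"
    by (simp add: norm_vec_def L2_set_le_sum)
  also have "\<dots> \<le> CARD('n) * c" using sum_bounded_above[of UNIV "\<lambda>i. norm (x $ i)" c] assms by simp
  finally show ?thesis .
qed

lemma quadratic_form_bound:
  fixes A :: "real^'n^'n" and D :: real
  assumes "\<And>i j. \<bar>A $ i $ j\<bar> \<le> D"
  shows "\<bar>z \<bullet> (A *v z)\<bar> \<le> (CARD('n))\<^sup>2 * D * (norm z)\<^sup>2"
proof -
  have "\<bar>z \<bullet> (A *v z)\<bar> \<le> norm z * norm (A *v z)" by (rule Cauchy_Schwarz_ineq2)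
  also have "\<dots> \<le> norm z * (CARD('n) * (CARD('n) * (D * norm z)))"
  proof (rule mult_left_mono[OF norm_le_card])
    fix i
    have "norm ((A *v z) $ i) \<le> (\<Sum>j\<in>UNIV. \<bar>A $ i $ j * z $ j\<bar>)"
      by (simp add: matrix_vector_mult_def sum_abs)
    also have "\<dots> \<le> (\<Sum>j\<in>(UNIV::'n set). D * norm z)"
      using assms component_le_norm_cart[of z] by (intro sum_mono) (auto simp: abs_mult intro!: mult_mono order_trans[OF abs_ge_zero])
    finally show "norm ((A *v z) $ i) \<le> CARD('n) * (D * norm z)" by simp
  qed simp
  finally show ?thesis by (simp add: power2_eq_square mult_ac)
qed

text \<open>Compactness of the unit sphere gives a positive minimum m at \<tau>, homogeneity extends
  it to all z, and a small perturbation costs at most half of it.\<close>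

lemma Siegel_uniformly_positive:
  fixes \<tau> :: "complex^'n^'n"
  assumes "\<tau> \<in> Siegel"
  obtains c \<epsilon> where "c > 0" "\<epsilon> > 0" "\<And>\<sigma> z. \<sigma> \<in> ball \<tau> \<epsilon> \<Longrightarrow> c * (norm z)\<^sup>2 \<le> z \<bullet> (Im_mat \<sigma> *v z)"
proof -
  have cont: "continuous_on (sphere 0 1) (\<lambda>z. z \<bullet> (Im_mat \<tau> *v z))"
    by (intro continuous_intros linear_continuous_on) (simp add: linear_conv_bounded_linear[symmetric] matrix_vector_mul_linear)
  have "sphere (0 :: real^'n) 1 \<noteq> {}" by simp
  then obtain u where u: "u \<in> sphere 0 1" "\<And>z. z \<in> sphere 0 1 \<Longrightarrow> u \<bullet> (Im_mat \<tau> *v u) \<le> z \<bullet> (Im_mat \<tau> *v z)"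
    using continuous_attains_inf[OF compact_sphere _ cont] by blast
  define m where "m = u \<bullet> (Im_mat \<tau> *v u)"
  have "u \<noteq> 0" using u(1) by auto
  then have m: "m > 0" unfolding m_def by (rule Siegel_pos[OF assms])
  have low: "m * (norm z)\<^sup>2 \<le> z \<bullet> (Im_mat \<tau> *v z)" for z
  proof (cases "z = 0")
    case False
    have "m \<le> sgn z \<bullet> (Im_mat \<tau> *v sgn z)"
      unfolding m_def by (rule u(2)) (simp add: norm_sgn False)
    also have "\<dots> = z \<bullet> (Im_mat \<tau> *v z) / (norm z)\<^sup>2"
      by (simp add: sgn_div_norm matrix_vector_mult_scaleR power2_eq_square divide_inverse)
    finally show ?thesis using False by (simp add: field_simps)
  qed simp
  \<comment> \<open>\<open>quadratic_form_bound\<close> contributes the square of the dimension, so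
    changing the entries by at most this \<epsilon> changes the form by at most m / 2 on unit
    vectors.\<close>
  define \<epsilon> where "\<epsilon> = m / (2 * (CARD('n))\<^sup>2)"
  have "m / 2 * (norm z)\<^sup>2 \<le> z \<bullet> (Im_mat \<sigma> *v z)" if "\<sigma> \<in> ball \<tau> \<epsilon>" for \<sigma> z
  proof -
    have "\<bar>(Im_mat \<sigma> - Im_mat \<tau>) $ i $ j\<bar> \<le> \<epsilon>" for i j
    proof -
      have "\<bar>(Im_mat \<sigma> - Im_mat \<tau>) $ i $ j\<bar> \<le> norm ((\<sigma> - \<tau>) $ i $ j)"
        using abs_Im_le_cmod[of "(\<sigma> - \<tau>) $ i $ j"] by (simp add: Im_mat_def)
      also have "\<dots> \<le> norm (\<sigma> - \<tau>)" by (rule norm_entry_le)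
      finally show ?thesis using that by (simp add: dist_norm norm_minus_commute)
    qed
    from quadratic_form_bound[of "Im_mat \<sigma> - Im_mat \<tau>", OF this, of z]
    have "\<bar>z \<bullet> ((Im_mat \<sigma> - Im_mat \<tau>) *v z)\<bar> \<le> m / 2 * (norm z)\<^sup>2" by (simp add: \<epsilon>_def)
    then have "\<bar>z \<bullet> (Im_mat \<sigma> *v z) - z \<bullet> (Im_mat \<tau> *v z)\<bar> \<le> m / 2 * (norm z)\<^sup>2"
      by (simp add: matrix_vector_mult_diff_rdistrib inner_diff_right)
    then show ?thesis using low[of z] unfolding abs_le_iff by (simp add: field_simps)
  qed
  moreover have "\<epsilon> > 0" using m by (simp add: \<epsilon>_def)
  ultimately show ?thesis using m by (intro that[of "m/2" \<epsilon>]) auto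
qed

text \<open>The trace is frame independent, so it may be computed on a unitary frame at \<sigma>,
  where it controls b. That frame is chosen separately for each \<sigma>, with no continuity; what
  counts is that its vectors, and the coordinates of \<open>siegel_frame\<close> in it, are bounded
  uniformly on the ball.\<close>

lemma gram_locally_bounded:
  fixes \<tau> :: "complex^'n^'n" and K :: real
  assumes "\<tau> \<in> Siegel"
  obtains \<epsilon> M :: real where "\<epsilon> > 0"
    "\<And>\<sigma> b a c. \<sigma> \<in> Siegel \<Longrightarrow> \<sigma> \<in> ball \<tau> \<epsilon> \<Longrightarrow> bilinear b \<Longrightarrow> hodge b \<Longrightarrow>
      rosati_norm (siegel_e \<sigma>) (\<lambda>i. axis i 1) b \<le> K \<Longrightarrow> \<bar>gram b \<sigma> a c\<bar> \<le> M"
proof -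
  obtain c \<epsilon> where c: "c > 0" "\<epsilon> > 0" "\<And>\<sigma> z. \<sigma> \<in> ball \<tau> \<epsilon> \<Longrightarrow> c * (norm z)\<^sup>2 \<le> z \<bullet> (Im_mat \<sigma> *v z)"
    using Siegel_uniformly_positive[OF assms] by metis
  \<comment> \<open>W bounds the w_k and the vectors of \<open>siegel_frame\<close>: entries of
    \<sigma> are at most norm \<tau> + 1 on a ball of radius at most 1, and (2 + norm \<tau>)^2
    dominates this too. In G, the factor W / c bounds \<open>siegel_p\<close>.\<close>
  define W where "W = CARD('n) * (2 + norm \<tau>)"
  define G where "G = W / c * W"
  have "1 \<le> real (CARD('n))" by (simp add: Suc_leI)
  then have W1: "W \<ge> 1" using mult_mono[of 1 "real (CARD('n))" 1 "2 + norm \<tau>"] by (simp add: W_def)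
  show ?thesis
  proof (rule that[of "min \<epsilon> 1"])
    fix \<sigma> b a a'
    assume \<sigma>: "\<sigma> \<in> Siegel" "\<sigma> \<in> ball \<tau> (min \<epsilon> 1)" and b: "bilinear b" "hodge b"
      "rosati_norm (siegel_e \<sigma>) (\<lambda>i. axis i 1) b \<le> K"
    have norm_\<sigma>: "norm \<sigma> \<le> norm \<tau> + 1"
      using norm_triangle_sub[of \<sigma> \<tau>] \<sigma>(2) by (simp add: dist_norm norm_minus_commute)
    \<comment> \<open>Coercivity of Im \<sigma> together with Cauchy-Schwarz bounds its
      inverse.\<close>
    have p: "norm (siegel_p \<sigma> x) \<le> norm (vec_Im x) / c" for x
    proof (cases "siegel_p \<sigma> x = 0")
      case False
      have "c * (norm (siegel_p \<sigma> x))\<^sup>2 \<le> siegel_p \<sigma> x \<bullet> vec_Im x"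
        using c(3)[of \<sigma> "siegel_p \<sigma> x"] \<sigma> by (simp add: Im_mat_siegel_p)
      also have "\<dots> \<le> norm (siegel_p \<sigma> x) * norm (vec_Im x)" by (rule norm_cauchy_schwarz)
      finally show ?thesis using False c(1) by (simp add: field_simps power2_eq_square)
    qed (use c in simp)
    obtain w :: "'n \<Rightarrow> real^'n" where w: "\<And>z. Im_mat \<sigma> *v z = (\<Sum>k\<in>UNIV. (z \<bullet> w k) *\<^sub>R w k)"
    proof (rule psd_sum_of_squares)
      show "transpose (Im_mat \<sigma>) = Im_mat \<sigma>"
        using \<sigma>(1) by (simp add: vec_eq_iff transpose_def Im_mat_def Siegel_sym)
      show "0 \<le> x \<bullet> (Im_mat \<sigma> *v x)" for x
        using Siegel_pos[OF \<sigma>(1), of x] by (cases "x = 0") auto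
    qed (rule that)
    have W: "norm (w k) \<le> W" for k
    proof -
      have "\<bar>w k $ i\<bar> \<le> 2 + norm \<tau>" for i
      proof -
        \<comment> \<open>The squares of the i-th entries of all the w_k add up to the i-th diagonal
          entry of Im \<sigma>.\<close>
        have "(w k $ i)\<^sup>2 \<le> (\<Sum>k\<in>UNIV. (w k $ i)\<^sup>2)" by (rule member_le_sum) auto
        also have "\<dots> = (Im_mat \<sigma> *v axis i 1) $ i"
          by (simp add: w inner_axis' power2_eq_square)
        also have "\<dots> = Im (\<sigma> $ i $ i)"
          by (simp add: matrix_vector_mult_def Im_mat_def axis_1_nth if_distrib[of "(*) _"] cong: if_cong)
        also have "\<dots> \<le> norm \<tau> + 1"
          using abs_Im_le_cmod[of "\<sigma> $ i $ i"] norm_entry_le[of \<sigma> i i] norm_\<sigma> by linarith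
        also have "\<dots> \<le> (2 + norm \<tau>)\<^sup>2" by (simp add: power2_eq_square algebra_simps)
        finally show ?thesis using abs_le_square_iff[of "w k $ i" "2 + norm \<tau>"] by simp
      qed
      then show ?thesis unfolding W_def by (intro norm_le_card) simp
    qed
    have fr: "norm (siegel_frame \<sigma> a) \<le> W" for a
    proof (cases a)
      case (Inl i)
      have "norm (\<sigma> $ m $ i) \<le> 2 + norm \<tau>" for m using norm_entry_le[of \<sigma> m i] norm_\<sigma> by linarith
      then show ?thesis unfolding W_def by (intro norm_le_card) (simp add: Inl siegel_frame_def siegel_e_nth)
    next
      case (Inr i)
      then show ?thesis using W1 by (simp add: siegel_frame_def norm_axis_1)
    qed
    have ReIm: "norm (vec_Re x) \<le> norm x" "norm (vec_Im x) \<le> norm x" for x :: "complex^'n"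
      unfolding norm_vec_def
      by (auto intro!: L2_set_mono simp: vec_Re_def vec_Im_def abs_Re_le_cmod abs_Im_le_cmod)
    let ?v = "\<lambda>k. complex_vec (w k)"
    have E1: "\<bar>siegel_form \<sigma> (siegel_frame \<sigma> a) (?v k)\<bar> \<le> G" for a k
    proof -
      have "\<bar>siegel_p \<sigma> (siegel_frame \<sigma> a) \<bullet> w k\<bar> \<le> norm (siegel_p \<sigma> (siegel_frame \<sigma> a)) * norm (w k)"
        by (rule Cauchy_Schwarz_ineq2)
      also have "\<dots> \<le> W / c * W"
        using c(1) W1 fr ReIm by (intro mult_mono W order_trans[OF p] divide_right_mono order_trans[OF ReIm(2)]) auto
      finally show ?thesis by (simp add: siegel_form_complex_vec[OF \<sigma>(1)] G_def)
    qed
    have E2: "\<bar>siegel_form \<sigma> (siegel_frame \<sigma> a) (\<i> *s ?v k)\<bar> \<le> G" for a k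
    proof -
      have "\<bar>siegel_p \<sigma> (\<i> *s ?v k) \<bullet> vec_Re (siegel_frame \<sigma> a)\<bar> \<le>
          norm (siegel_p \<sigma> (\<i> *s ?v k)) * norm (vec_Re (siegel_frame \<sigma> a))"
        by (rule Cauchy_Schwarz_ineq2)
      also have "\<dots> \<le> W / c * W"
        using c(1) W1 fr W by (intro mult_mono order_trans[OF p] divide_right_mono order_trans[OF ReIm(1)]) auto
      finally show ?thesis by (simp add: siegel_form_complex_vec[OF \<sigma>(1)] G_def)
    qed
    have frame: "symplectic_frame (siegel_form \<sigma>) (\<lambda>k. \<i> *s ?v k) ?v"
      by (rule unitary_frame[OF \<sigma>(1) w])
    have "rosati_norm (\<lambda>k. \<i> *s ?v k) ?v b = rosati_norm (siegel_e \<sigma>) (\<lambda>i. axis i 1) b"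
      by (rule rosati_norm_frame_independent[OF b(1) bilinear_siegel_form siegel_form_swap frame
            siegel_symplectic_frame[OF \<sigma>(1)]])
    then have "rosati_norm (\<lambda>k. \<i> *s ?v k) ?v b \<le> K" using b(3) by simp
    from hodge_bound[OF b(1,2) frame this E1 E2 E1 E2]
    show "\<bar>gram b \<sigma> a a'\<bar> \<le> (real (CARD('n)))\<^sup>2 * (4 * (G\<^sup>2 * (K + 1)))" by (simp add: gram_def)
  qed (use c in simp)
qed

section \<open>Analytic subsets of the Siegel space\<close>

abbreviation mat_holomorphic :: "(complex^'n^'n \<Rightarrow> complex) \<Rightarrow> bool" where
  "mat_holomorphic f \<equiv> holomorphic_wrt mat_scale f UNIV"

lemma mat_holomorphic_const: "mat_holomorphic (\<lambda>\<tau>. c)"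
  unfolding holomorphic_wrt_def by (intro ballI exI[of _ "\<lambda>_. 0"]) auto

lemma mat_holomorphic_entry: "mat_holomorphic (\<lambda>\<tau> :: complex^'n^'n. \<tau> $ i $ j)"
proof -
  have "((\<lambda>\<tau> :: complex^'n^'n. \<tau> $ i $ j) has_derivative (\<lambda>\<tau>. \<tau> $ i $ j)) (at x)" for x
    by (intro linear_imp_has_derivative linearI) auto
  then show ?thesis unfolding holomorphic_wrt_def mat_scale_def by (intro ballI exI conjI) auto
qed

lemma mat_holomorphic_add:
  fixes f g :: "complex^'n^'n \<Rightarrow> complex"
  assumes "mat_holomorphic f" "mat_holomorphic g"
  shows "mat_holomorphic (\<lambda>\<tau>. f \<tau> + g \<tau>)"
  unfolding holomorphic_wrt_def
proof
  fix x :: "complex^'n^'n"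
  obtain f' g' where
    "(f has_derivative f') (at x)" "\<forall>c u. f' (mat_scale c u) = c * f' u"
    "(g has_derivative g') (at x)" "\<forall>c u. g' (mat_scale c u) = c * g' u"
    using assms unfolding holomorphic_wrt_def by (metis UNIV_I)
  then show "\<exists>D. ((\<lambda>\<tau>. f \<tau> + g \<tau>) has_derivative D) (at x) \<and> (\<forall>c u. D (mat_scale c u) = c * D u)"
    by (intro exI[of _ "\<lambda>h. f' h + g' h"]) (auto intro: has_derivative_add simp: algebra_simps)
qed

lemma mat_holomorphic_mult:
  fixes f g :: "complex^'n^'n \<Rightarrow> complex"
  assumes "mat_holomorphic f" "mat_holomorphic g"
  shows "mat_holomorphic (\<lambda>\<tau>. f \<tau> * g \<tau>)"
  unfolding holomorphic_wrt_def
proof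
  fix x :: "complex^'n^'n"
  obtain f' g' where
    "(f has_derivative f') (at x)" "\<forall>c u. f' (mat_scale c u) = c * f' u"
    "(g has_derivative g') (at x)" "\<forall>c u. g' (mat_scale c u) = c * g' u"
    using assms unfolding holomorphic_wrt_def by (metis UNIV_I)
  then show "\<exists>D. ((\<lambda>\<tau>. f \<tau> * g \<tau>) has_derivative D) (at x) \<and> (\<forall>c u. D (mat_scale c u) = c * D u)"
    by (intro exI[of _ "\<lambda>h. f x * g' h + f' h * g x"]) (auto intro: has_derivative_mult simp: algebra_simps)
qed

lemma mat_holomorphic_diff:
  assumes "mat_holomorphic f" "mat_holomorphic g"
  shows "mat_holomorphic (\<lambda>\<tau>. f \<tau> - g \<tau>)"
  using mat_holomorphic_add[OF assms(1) mat_holomorphic_mult[OF mat_holomorphic_const[of "-1"] assms(2)]] by simp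

lemma mat_holomorphic_sum:
  assumes "\<And>i. i \<in> I \<Longrightarrow> mat_holomorphic (f i)"
  shows "mat_holomorphic (\<lambda>\<tau>. \<Sum>i\<in>I. f i \<tau>)"
  using assms
  by (induction I rule: infinite_finite_induct) (auto intro: mat_holomorphic_const mat_holomorphic_add)

lemma mat_holomorphic_continuous: "mat_holomorphic f \<Longrightarrow> continuous_on UNIV f"
  unfolding holomorphic_wrt_def continuous_on_eq_continuous_at[OF open_UNIV]
  using has_derivative_continuous by blast

section \<open>Local equations of the Hodge loci\<close>

lemma hodge_eq_holomorphic: "mat_holomorphic (hodge_eq N i j)"
proof -
  have "mat_holomorphic (\<lambda>\<tau>. hodge_eq N i j \<tau>)"
    unfolding hodge_eq_def
    by (intro mat_holomorphic_add mat_holomorphic_diff mat_holomorphic_sum mat_holomorphic_mult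
        mat_holomorphic_const mat_holomorphic_entry)
  then show ?thesis .
qed

text \<open>A union of two zero loci is cut out by the products of one equation from each; the empty
  union is cut out by the constant 1.\<close>

lemma finite_union_zero_locus:
  assumes "finite \<N>"
  shows "\<exists>S. finite S \<and> (\<forall>f\<in>S. mat_holomorphic f) \<and>
    (\<forall>\<tau>. (\<exists>N\<in>\<N>. \<forall>i j. hodge_eq N i j \<tau> = 0) \<longleftrightarrow> (\<forall>f\<in>S. f \<tau> = 0))"
  using assms
proof (induction \<N> rule: finite_induct)
  case empty
  show ?case by (intro exI[of _ "{\<lambda>_. 1}"]) (auto intro: mat_holomorphic_const)
next
  case (insert N \<N>)
  then obtain S where S: "finite S" "\<forall>f\<in>S. mat_holomorphic f"
    "\<forall>\<tau>. (\<exists>N\<in>\<N>. \<forall>i j. hodge_eq N i j \<tau> = 0) \<longleftrightarrow> (\<forall>f\<in>S. f \<tau> = 0)" by blast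
  let ?H = "range (\<lambda>(i, j). hodge_eq N i j)"
  let ?S = "(\<lambda>(f, g) \<tau>. f \<tau> * g \<tau>) ` (S \<times> ?H)"
  have "(\<exists>N\<in>insert N \<N>. \<forall>i j. hodge_eq N i j \<tau> = 0) \<longleftrightarrow> (\<forall>f\<in>?S. f \<tau> = 0)" for \<tau>
    using S(3)[rule_format, of \<tau>] by auto
  moreover have "finite ?S" using S(1) by auto
  moreover have "\<forall>f\<in>?S. mat_holomorphic f"
    using S(2) by (auto intro!: mat_holomorphic_mult hodge_eq_holomorphic)
  ultimately show ?case by (intro exI[of _ ?S]) blast
qed

text \<open>Multiplying by the weights turns N into an integral matrix with entries bounded by R,
  and the weights are nonzero.\<close>

lemma finite_admissible_bounded:
  fixes d :: "'n::finite \<Rightarrow> nat"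
  assumes "\<And>i. d i > 0"
  shows "finite {N. admissible d k N \<and> (\<forall>a c. \<bar>N a c\<bar> \<le> M)}"
proof -
  have w: "siegel_weight d a \<noteq> 0" for a
    using assms by (simp add: siegel_weight_def split: sum.split)
  define R where "R = Max (range (\<lambda>(a, c). \<bar>siegel_weight d a * siegel_weight d c\<bar> * \<bar>M\<bar>))"
  have R: "\<bar>siegel_weight d a * siegel_weight d c\<bar> * \<bar>M\<bar> \<le> R" for a c
    unfolding R_def by (rule Max_ge) auto
  let ?T = "{x \<in> \<int>. \<bar>x\<bar> \<le> R}"
  have fin: "finite ?T" by (rule finite_abs_int_segment)
  let ?F = "{G :: 'n + 'n \<Rightarrow> 'n + 'n \<Rightarrow> real. \<forall>a. G a \<in> {g. \<forall>c. g c \<in> ?T}}"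
  have "finite {g :: 'n + 'n \<Rightarrow> real. \<forall>c. g c \<in> ?T}"
    using finite_PiE[of "UNIV :: ('n + 'n) set" "\<lambda>_. ?T"] fin by (simp add: PiE_UNIV_domain Pi_def)
  then have finF: "finite ?F"
    using finite_PiE[of "UNIV :: ('n + 'n) set" "\<lambda>_. {g :: 'n + 'n \<Rightarrow> real. \<forall>c. g c \<in> ?T}"]
    by (simp add: PiE_UNIV_domain Pi_def)
  have "{N. admissible d k N \<and> (\<forall>a c. \<bar>N a c\<bar> \<le> M)} \<subseteq>
      (\<lambda>G a c. G a c / (siegel_weight d a * siegel_weight d c)) ` ?F"
  proof
    fix N assume N: "N \<in> {N. admissible d k N \<and> (\<forall>a c. \<bar>N a c\<bar> \<le> M)}"
    let ?G = "\<lambda>a c. siegel_weight d a * siegel_weight d c * N a c"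
    have "\<bar>?G a c\<bar> \<le> R" for a c
    proof -
      have "\<bar>N a c\<bar> \<le> \<bar>M\<bar>" using N by (auto intro: order_trans[OF _ abs_ge_self])
      then have "\<bar>?G a c\<bar> \<le> \<bar>siegel_weight d a * siegel_weight d c\<bar> * \<bar>M\<bar>"
        unfolding abs_mult[of _ "N a c"] by (rule mult_left_mono) simp
      then show ?thesis using R by (rule order_trans)
    qed
    then have G: "?G \<in> ?F" using N by (auto simp: admissible_def)
    show "N \<in> (\<lambda>G a c. G a c / (siegel_weight d a * siegel_weight d c)) ` ?F"
      by (rule image_eqI[OF _ G]) (use w in \<open>simp add: fun_eq_iff\<close>)
  qed
  then show ?thesis using finF by (meson finite_imageI finite_subset)
qed

text \<open>The bound M is valid on the whole ball, so the finite list of candidate matrices can be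
  fixed before \<sigma>.\<close>

lemma hodge_locus_locally:
  fixes d :: "'n::finite \<Rightarrow> nat" and \<tau> :: "complex^'n^'n"
  assumes "\<And>i. d i > 0" "\<tau> \<in> Siegel"
  obtains \<epsilon> \<N> where "\<epsilon> > 0" "finite \<N>" "\<And>N. N \<in> \<N> \<Longrightarrow> admissible d k N"
    "\<And>\<sigma>. \<sigma> \<in> ball \<tau> \<epsilon> \<Longrightarrow> \<sigma> \<in> Siegel \<Longrightarrow>
      \<sigma> \<in> hodge_locus d k \<longleftrightarrow> (\<exists>N\<in>\<N>. \<forall>i j. hodge_eq N i j \<sigma> = 0)"
proof -
  obtain \<epsilon> M where \<epsilon>: "\<epsilon> > 0" and M: "\<And>\<sigma> b a c. \<sigma> \<in> Siegel \<Longrightarrow> \<sigma> \<in> ball \<tau> \<epsilon> \<Longrightarrow> bilinear b \<Longrightarrow>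
      hodge b \<Longrightarrow> rosati_norm (siegel_e \<sigma>) (\<lambda>i. axis i 1) b \<le> real k \<Longrightarrow> \<bar>gram b \<sigma> a c\<bar> \<le> M"
    using gram_locally_bounded[OF assms(2), of "real k"] by metis
  let ?N = "{N. admissible d k N \<and> (\<forall>a c. \<bar>N a c\<bar> \<le> M)}"
  have "\<sigma> \<in> hodge_locus d k \<longleftrightarrow> (\<exists>N\<in>?N. \<forall>i j. hodge_eq N i j \<sigma> = 0)"
    if \<sigma>: "\<sigma> \<in> ball \<tau> \<epsilon>" "\<sigma> \<in> Siegel" for \<sigma>
  proof -
    have "\<bar>N a c\<bar> \<le> M" if N: "admissible d k N" "\<forall>i j. hodge_eq N i j \<sigma> = 0" for N a c
    proof -
      have "hodge (form_of N \<sigma>)"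
        using hodge_iff_hodge_eq[OF \<sigma>(2) bilinear_form_of] N(2) by (simp add: gram_form_of[OF \<sigma>(2)])
      moreover have "rosati_norm (siegel_e \<sigma>) (\<lambda>i. axis i 1) (form_of N \<sigma>) \<le> real k"
        using N(1) by (simp add: rosati_norm_gram gram_form_of[OF \<sigma>(2)] admissible_def)
      ultimately have "\<bar>gram (form_of N \<sigma>) \<sigma> a c\<bar> \<le> M"
        by (rule M[OF \<sigma>(2,1) bilinear_form_of])
      then show ?thesis by (simp add: gram_form_of[OF \<sigma>(2)])
    qed
    then show ?thesis unfolding hodge_locus_iff using \<sigma>(2) by blast
  qed
  then show ?thesis
    using that[of \<epsilon> ?N] \<epsilon> finite_admissible_bounded[of d k M, OF assms(1)] by blast
qed

lemma hodge_locus_analytic: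
  fixes d :: "'n::finite \<Rightarrow> nat"
  assumes "\<And>i. d i > 0"
  shows "analytic_subset (hodge_locus d k)"
  unfolding analytic_subset_def
proof (intro conjI ballI)
  show sub: "hodge_locus d k \<subseteq> Siegel" by (auto simp: hodge_locus_def)
  fix \<tau> :: "complex^'n^'n" assume \<tau>: "\<tau> \<in> Siegel"
  obtain \<epsilon> \<N> where \<epsilon>: "\<epsilon> > 0" "finite \<N>" "\<And>N. N \<in> \<N> \<Longrightarrow> admissible d k N"
    "\<And>\<sigma>. \<sigma> \<in> ball \<tau> \<epsilon> \<Longrightarrow> \<sigma> \<in> Siegel \<Longrightarrow>
      \<sigma> \<in> hodge_locus d k \<longleftrightarrow> (\<exists>N\<in>\<N>. \<forall>i j. hodge_eq N i j \<sigma> = 0)"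
    by (rule hodge_locus_locally[where d = d and k = k, OF assms \<tau>]) (rule that)
  obtain S where S: "finite S" "\<forall>f\<in>S. mat_holomorphic f"
    "\<forall>\<tau>. (\<exists>N\<in>\<N>. \<forall>i j. hodge_eq N i j \<tau> = 0) \<longleftrightarrow> (\<forall>f\<in>S. f \<tau> = 0)"
    using finite_union_zero_locus[OF \<epsilon>(2)] by blast
  have "hodge_locus d k \<inter> ball \<tau> \<epsilon> = {\<sigma> \<in> Siegel \<inter> ball \<tau> \<epsilon>. \<forall>f\<in>S. f \<sigma> = 0}"
    using \<epsilon>(4) S(3) sub by (intro Set.set_eqI) blast
  moreover have "\<forall>f\<in>S. holomorphic_wrt mat_scale f (ball \<tau> \<epsilon>)"
    using S(2) by (auto simp: holomorphic_wrt_def)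
  ultimately show "\<exists>\<epsilon>>0. \<exists>S. finite S \<and> (\<forall>f\<in>S. holomorphic_wrt mat_scale f (ball \<tau> \<epsilon>)) \<and>
      hodge_locus d k \<inter> ball \<tau> \<epsilon> = {\<sigma> \<in> Siegel \<inter> ball \<tau> \<epsilon>. \<forall>f\<in>S. f \<sigma> = 0}"
    using \<epsilon>(1) S(1) by blast
qed

section \<open>Density of the complements of the Hodge loci\<close>

lemma quadratic_vanishing:
  fixes a b c :: complex
  assumes "\<delta> > 0" "\<And>t::real. \<bar>t\<bar> < \<delta> \<Longrightarrow> a + of_real t * b + of_real (t\<^sup>2) * c = 0"
  shows "a = 0 \<and> b = 0 \<and> c = 0"
proof -
  \<comment> \<open>The values at 0, t and -t separate the three coefficients.\<close>
  define t where "t = \<delta> / 2"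
  have t: "t > 0" "\<bar>t\<bar> < \<delta>" "\<bar>- t\<bar> < \<delta>" using assms(1) by (auto simp: t_def)
  have a: "a = 0" using assms(2)[of 0] assms(1) by simp
  have "of_real t * b + of_real (t\<^sup>2) * c = 0" "- of_real t * b + of_real (t\<^sup>2) * c = 0"
    using assms(2)[OF t(2)] assms(2)[OF t(3)] a by simp_all
  then have "2 * of_real t * b = 0" "2 * of_real (t\<^sup>2) * c = 0" by algebra+
  then show ?thesis using a t(1) by simp
qed

definition real_sym :: "('n \<Rightarrow> 'n \<Rightarrow> real) \<Rightarrow> complex^'n^'n" where
  "real_sym H = (\<chi> i j. of_real (H i j))"

text \<open>Im \<tau> is unchanged, so the entire line stays in the Siegel space and positivity
  never restricts t.\<close>

lemma Siegel_add_real_sym: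
  assumes "\<tau> \<in> Siegel" "\<And>i j. H i j = H j i"
  shows "\<tau> + t *\<^sub>R real_sym H \<in> Siegel"
proof -
  have "Im_mat (\<tau> + t *\<^sub>R real_sym H) = Im_mat \<tau>"
    by (simp add: Im_mat_def real_sym_def vec_eq_iff)
  moreover have "transpose (\<tau> + t *\<^sub>R real_sym H) = \<tau> + t *\<^sub>R real_sym H"
    using Siegel_sym[OF assms(1)] assms(2) by (simp add: transpose_def vec_eq_iff real_sym_def)
  ultimately show ?thesis using assms(1) by (simp add: Siegel_def)
qed

text \<open>Expansion along the lines \<open>\<tau> + t H\<close>, \<open>H\<close> real symmetric: the quadratic term with \<open>H = 1\<close> kills the
  block of \<open>f\<close>'s, the linear one shows that the mixed block commutes with all such \<open>H\<close>.\<close>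

lemma hodge_eq_vanishing_imp_multiple:
  fixes N :: "'n::finite + 'n \<Rightarrow> 'n + 'n \<Rightarrow> real" and \<tau> :: "complex^'n^'n"
  assumes \<tau>: "\<tau> \<in> Siegel" and "\<delta> > 0"
    and van: "\<And>\<sigma> i j. \<sigma> \<in> Siegel \<Longrightarrow> \<sigma> \<in> ball \<tau> \<delta> \<Longrightarrow> hodge_eq N i j \<sigma> = 0"
  shows "\<exists>q. \<forall>a c. N a c = q * standard_symplectic a c"
proof -
  define A where "A H i j = - (\<Sum>m\<in>UNIV. H m j * N (Inl i) (Inr m)) - (\<Sum>m\<in>UNIV. H m i * N (Inr m) (Inl j))"
    for H :: "'n \<Rightarrow> 'n \<Rightarrow> real" and i j
  define B where "B H i j = (\<Sum>m\<in>UNIV. \<Sum>l\<in>UNIV. of_real (H m i) * \<tau> $ l $ j * of_real (N (Inr m) (Inr l)))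
     + (\<Sum>m\<in>UNIV. \<Sum>l\<in>UNIV. \<tau> $ m $ i * of_real (H l j) * of_real (N (Inr m) (Inr l)))"
    for H :: "'n \<Rightarrow> 'n \<Rightarrow> real" and i j
  define C where "C H i j = (\<Sum>m\<in>UNIV. \<Sum>l\<in>UNIV. H m i * H l j * N (Inr m) (Inr l))"
    for H :: "'n \<Rightarrow> 'n \<Rightarrow> real" and i j
  have exp: "hodge_eq N i j (\<tau> + t *\<^sub>R real_sym H) =
      hodge_eq N i j \<tau> + of_real t * (of_real (A H i j) + B H i j) + of_real (t\<^sup>2) * of_real (C H i j)" for t H i j
    by (simp add: hodge_eq_def real_sym_def A_def B_def C_def algebra_simps sum.distrib sum_distrib_left
        sum_subtractf scaleR_conv_of_real[where 'a = complex] power2_eq_square)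
  have AB: "of_real (A H i j) + B H i j = 0 \<and> C H i j = 0 \<and> hodge_eq N i j \<tau> = 0" if H: "\<And>i j. H i j = H j i" for H i j
  proof -
    let ?n = "norm (real_sym H) + 1"
    have "hodge_eq N i j (\<tau> + t *\<^sub>R real_sym H) = 0" if t: "\<bar>t\<bar> < \<delta> / ?n" for t
    proof (rule van)
      have n: "?n > 0" using norm_ge_zero[of "real_sym H"] by linarith
      have "\<bar>t\<bar> * norm (real_sym H) \<le> \<bar>t\<bar> * ?n" by (intro mult_left_mono) auto
      also have "\<dots> < \<delta>" using t n by (simp add: field_simps)
      finally show "\<tau> + t *\<^sub>R real_sym H \<in> ball \<tau> \<delta>" by (simp add: dist_norm)
    qed (rule Siegel_add_real_sym[OF \<tau> H])
    moreover have "\<delta> / ?n > 0" using assms(2) by (simp add: add_nonneg_pos)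
    ultimately show ?thesis
      using quadratic_vanishing[of "\<delta> / ?n" "hodge_eq N i j \<tau>" "of_real (A H i j) + B H i j" "of_real (C H i j)"]
      unfolding exp by simp
  qed
  have S: "N (Inr i) (Inr j) = 0" for i j
  proof -
    have "C (\<lambda>i j. of_bool (i = j)) i j = 0" using AB[of "\<lambda>i j. of_bool (i = j)" i j] by auto
    then show ?thesis
      by (simp add: C_def of_bool_def if_distrib[of "\<lambda>x. x * _"] if_distrib[of "(*) _"] cong: if_cong)
  qed
  have A0: "A H i j = 0" if "\<And>i j. H i j = H j i" for H i j
    using AB[of H i j] that by (simp add: B_def S)
  \<comment> \<open>The linear term with H = 1 makes the two mixed blocks opposite to each
    other.\<close>
  have R: "N (Inr i) (Inl j) = - N (Inl i) (Inr j)" for i j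
    using A0[of "\<lambda>i j. of_bool (i = j)" i j]
    by (simp add: A_def of_bool_def if_distrib[of "\<lambda>x. x * _"] cong: if_cong)
  have comm: "(\<Sum>m\<in>UNIV. H m j * N (Inl i) (Inr m)) = (\<Sum>m\<in>UNIV. H m i * N (Inl m) (Inr j))"
    if "\<And>i j. H i j = H j i" for H i j
    using A0[of H i j, OF that] by (simp add: A_def R sum_negf)
  \<comment> \<open>Commutation with the matrix unit E_jj removes the off-diagonal entries of column
    j.\<close>
  have off: "N (Inl i) (Inr j) = 0" if "i \<noteq> j" for i j
    using comm[of "\<lambda>i l. of_bool (i = j \<and> l = j)" j i] that
    by (simp add: of_bool_def if_distrib[of "\<lambda>x. x * _"] cong: if_cong)
  \<comment> \<open>Commutation with E_ij + E_ji equates two diagonal entries, so the mixed block is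
    scalar.\<close>
  have diag: "N (Inl i) (Inr i) = N (Inl j) (Inr j)" if "i \<noteq> j" for i j
    using comm[of "\<lambda>k l. of_bool (k = i \<and> l = j) + of_bool (k = j \<and> l = i)" j i] that
    by (simp add: of_bool_def if_distrib[of "\<lambda>x. x * _"] if_distrib[of "(*) _"] algebra_simps sum.distrib
        cong: if_cong)
  obtain i0 :: 'n where True by blast
  define q where "q = N (Inl i0) (Inr i0)"
  have Q: "N (Inl i) (Inr j) = q * of_bool (i = j)" for i j
  proof (cases "i = j")
    case True
    have "N (Inl i) (Inr i) = q" using diag[of i i0] unfolding q_def by (cases "i = i0") blast+
    then show ?thesis using True by simp
  qed (simp add: off)
  \<comment> \<open>In the constant term the contributions q \<tau>_ij and q \<tau>_ji of the mixed
    blocks cancel by symmetry of \<tau>.\<close>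
  have P: "N (Inl i) (Inl j) = 0" for i j
  proof -
    have "hodge_eq N i j \<tau> = 0" using AB[of "\<lambda>_ _. 0" i j] by simp
    then show ?thesis
      by (simp add: hodge_eq_def S Q R Siegel_sym[OF \<tau>, of j i] of_bool_def if_distrib[of "(*) _"]
          if_distrib[of of_real] if_distrib[of uminus] cong: if_cong)
  qed
  have "N a c = q * standard_symplectic a c" for a c
    by (cases a; cases c) (simp_all add: P Q R S standard_symplectic_def)
  then show ?thesis by blast
qed

text \<open>The complement of the loci treated so far is open, and the equations of the next matrix
  cannot all vanish identically on a ball inside it.\<close>

lemma finite_zero_loci_codense:
  fixes \<tau> :: "complex^'n^'n"
  assumes "finite \<N>" "\<And>N. N \<in> \<N> \<Longrightarrow> \<nexists>q. \<forall>a c. N a c = q * standard_symplectic a c" "\<tau> \<in> Siegel" "\<epsilon> > 0"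
  shows "\<exists>\<sigma>\<in>Siegel \<inter> ball \<tau> \<epsilon>. \<forall>N\<in>\<N>. \<exists>i j. hodge_eq N i j \<sigma> \<noteq> 0"
  using assms
proof (induction \<N> arbitrary: \<tau> \<epsilon> rule: finite_induct)
  case empty
  then show ?case by force
next
  case (insert N \<N>)
  then obtain \<sigma> where \<sigma>: "\<sigma> \<in> Siegel" "\<sigma> \<in> ball \<tau> \<epsilon>" "\<forall>N\<in>\<N>. \<exists>i j. hodge_eq N i j \<sigma> \<noteq> 0"
    by (metis Int_iff insertCI)
  let ?U = "ball \<tau> \<epsilon> \<inter> (\<Inter>N\<in>\<N>. \<Union>i. \<Union>j. {\<sigma>. hodge_eq N i j \<sigma> \<noteq> 0})"
  have "open ?U"
    using insert.hyps(1) mat_holomorphic_continuous[OF hodge_eq_holomorphic]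
    by (intro open_Int open_INT open_UN ballI open_ball open_Collect_neq continuous_on_const) auto
  moreover have "\<sigma> \<in> ?U" using \<sigma> by auto
  ultimately obtain \<delta> where \<delta>: "\<delta> > 0" "ball \<sigma> \<delta> \<subseteq> ?U"
    by (meson open_contains_ball)
  obtain \<sigma>' i j where "\<sigma>' \<in> Siegel" "\<sigma>' \<in> ball \<sigma> \<delta>" "hodge_eq N i j \<sigma>' \<noteq> 0"
    using hodge_eq_vanishing_imp_multiple[OF \<sigma>(1) \<delta>(1), of N] insert.prems(1)[of N] by blast
  then show ?case using \<delta>(2) by (intro bexI[of _ \<sigma>']) auto
qed

lemma hodge_locus_codense:
  fixes d :: "'n::finite \<Rightarrow> nat"
  assumes "\<And>i. d i > 0"
  shows "Siegel \<subseteq> closure (Siegel - hodge_locus d k)"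
proof
  fix \<tau> :: "complex^'n^'n" assume \<tau>: "\<tau> \<in> Siegel"
  obtain \<epsilon> \<N> where \<epsilon>: "\<epsilon> > 0" "finite \<N>" "\<And>N. N \<in> \<N> \<Longrightarrow> admissible d k N"
    "\<And>\<sigma>. \<sigma> \<in> ball \<tau> \<epsilon> \<Longrightarrow> \<sigma> \<in> Siegel \<Longrightarrow>
      \<sigma> \<in> hodge_locus d k \<longleftrightarrow> (\<exists>N\<in>\<N>. \<forall>i j. hodge_eq N i j \<sigma> = 0)"
    by (rule hodge_locus_locally[where d = d and k = k, OF assms \<tau>]) (rule that)
  show "\<tau> \<in> closure (Siegel - hodge_locus d k)"
    unfolding closure_approachable
  proof (intro allI impI)
    fix e :: real assume "e > 0"
    then have e: "min e \<epsilon> > 0" using \<epsilon>(1) by simp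
    have "\<nexists>q. \<forall>a c. N a c = q * standard_symplectic a c" if "N \<in> \<N>" for N
      using \<epsilon>(3)[OF that] unfolding admissible_def by blast
    from finite_zero_loci_codense[OF \<epsilon>(2) this \<tau> e]
    obtain \<sigma> where "\<sigma> \<in> Siegel" "\<sigma> \<in> ball \<tau> (min e \<epsilon>)" "\<forall>N\<in>\<N>. \<exists>i j. hodge_eq N i j \<sigma> \<noteq> 0"
      by blast
    then show "\<exists>\<sigma>\<in>Siegel - hodge_locus d k. dist \<sigma> \<tau> < e"
      using \<epsilon>(4)[of \<sigma>] by (intro bexI[of _ \<sigma>]) (auto simp: dist_commute)
  qed
qed

section \<open>Subloci of the moduli space\<close>

definition clinear_iso :: "(complex^'n \<Rightarrow> complex^'m) \<Rightarrow> (complex^'m \<Rightarrow> complex^'n) \<Rightarrow> bool" where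
  "clinear_iso a b \<longleftrightarrow> clinear a \<and> clinear b \<and> (\<forall>v. b (a v) = v) \<and> (\<forall>w. a (b w) = w)"

lemma clinear_comp: "clinear f \<Longrightarrow> clinear g \<Longrightarrow> clinear (f \<circ> g)"
  unfolding clinear_def by (auto intro: linear_compose)

lemma clinear_iso_comp: "clinear_iso a b \<Longrightarrow> clinear_iso p q \<Longrightarrow> clinear_iso (a \<circ> p) (q \<circ> b)"
  unfolding clinear_iso_def by (auto intro: clinear_comp)

lemma clinear_iso_sym: "clinear_iso a b \<Longrightarrow> clinear_iso b a"
  unfolding clinear_iso_def by auto

lemma clinear_iso_id: "clinear_iso id id"
  unfolding clinear_iso_def clinear_def by (auto intro: linear_id)

lemma bilinear_compose:
  assumes "bilinear b" "linear f"
  shows "bilinear (\<lambda>x y. b (f x) (f y))"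
  using assms unfolding bilinear_def by (auto intro: linear_compose[unfolded comp_def])

text \<open>Isomorphism with a member of the family over W, where polarisations are compared by
  Riemann forms and not by isomorphisms of bundles: a Riemann form depends only on the Neron-Severi
  class.\<close>

definition moduli_locus :: "('n::finite \<Rightarrow> nat) \<Rightarrow> (complex^'n^'n) set \<Rightarrow> 'n polarised set" where
  "moduli_locus d W = {(L, e). \<exists>\<tau>\<in>W. \<exists>a b. clinear_iso a b \<and> a ` L = Siegel_lattice d \<tau> \<and>
     riemann_form L e (\<lambda>x y. siegel_form \<tau> (a x) (a y))}"

text \<open>Composing with the linear part of the isomorphism, or with its inverse, changes the
  marking a but keeps \<tau>.\<close>

lemma moduli_locus_invariant:
  assumes A: "A \<in> polarised_AVs d" and B: "B \<in> polarised_AVs d" and iso: "polarised_iso A B"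
  shows "A \<in> moduli_locus d W \<longleftrightarrow> B \<in> moduli_locus d W"
proof -
  obtain L e where Le: "A = (L, e)" by (cases A)
  obtain L' e' where Le': "B = (L', e')" by (cases B)
  obtain F where F: "torus_iso L L' F" "NS_equiv L (pullback F e') e"
    using iso by (auto simp: polarised_iso_def Le Le')
  have "lattice_in L" "lattice_in L'" using A B by (auto simp: polarised_AVs_def Le Le')
  from this F(1) obtain p q where pq: "clinear p" "clinear q" "\<And>v. q (p v) = v" "\<And>w. p (q w) = w"
    "p ` L = L'" "\<And>v. F v = p v + F 0"
    by (rule torus_iso_affine) (rule that)
  have pq_iso: "clinear_iso p q" using pq by (auto simp: clinear_iso_def)
  have form: "riemann_form L e (\<lambda>x y. E (p x) (p y)) \<longleftrightarrow> riemann_form L' e' E" for E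
    using riemann_form_NS_equiv[OF F(2)] riemann_form_pullback[OF pq] by blast
  show ?thesis
  proof
    assume "A \<in> moduli_locus d W"
    then obtain \<tau> a b where \<tau>: "\<tau> \<in> W" "clinear_iso a b" "a ` L = Siegel_lattice d \<tau>"
      "riemann_form L e (\<lambda>x y. siegel_form \<tau> (a x) (a y))"
      unfolding moduli_locus_def Le by blast
    have "(a \<circ> q) ` L' = Siegel_lattice d \<tau>"
      using \<tau>(3) pq(3) by (simp add: pq(5)[symmetric] image_comp comp_def)
    moreover have "riemann_form L' e' (\<lambda>x y. siegel_form \<tau> ((a \<circ> q) x) ((a \<circ> q) y))"
      using \<tau>(4) form[of "\<lambda>x y. siegel_form \<tau> ((a \<circ> q) x) ((a \<circ> q) y)"] by (simp add: pq(3))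
    ultimately show "B \<in> moduli_locus d W"
      using \<tau>(1) clinear_iso_comp[OF \<tau>(2) clinear_iso_sym[OF pq_iso]]
      unfolding moduli_locus_def Le' by blast
  next
    assume "B \<in> moduli_locus d W"
    then obtain \<tau> a b where \<tau>: "\<tau> \<in> W" "clinear_iso a b" "a ` L' = Siegel_lattice d \<tau>"
      "riemann_form L' e' (\<lambda>x y. siegel_form \<tau> (a x) (a y))"
      unfolding moduli_locus_def Le' by blast
    have "(a \<circ> p) ` L = Siegel_lattice d \<tau>"
      using \<tau>(3) by (simp add: pq(5)[symmetric] image_comp)
    moreover have "riemann_form L e (\<lambda>x y. siegel_form \<tau> ((a \<circ> p) x) ((a \<circ> p) y))"
      using \<tau>(4) form[of "\<lambda>x y. siegel_form \<tau> (a x) (a y)"] by simp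
    ultimately show "A \<in> moduli_locus d W"
      using \<tau>(1) clinear_iso_comp[OF \<tau>(2) pq_iso] unfolding moduli_locus_def Le by blast
  qed
qed

lemma Siegel_AV_in_moduli_locus:
  assumes "\<tau> \<in> W" "W \<subseteq> Siegel"
  shows "Siegel_AV d \<tau> \<in> moduli_locus d W"
proof -
  have "riemann_form (Siegel_lattice d \<tau>) (Siegel_bundle \<tau>) (\<lambda>x y. siegel_form \<tau> (id x) (id y))"
    using riemann_form_Siegel subsetD[OF assms(2,1)] by simp
  moreover have "id ` Siegel_lattice d \<tau> = Siegel_lattice d \<tau>" by simp
  ultimately show ?thesis
    unfolding moduli_locus_def Siegel_AV_def using assms(1) clinear_iso_id by blast
qed

text \<open>All conditions pull back along a. For the trace, a carries the standard frame at \<tau>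
  to a symplectic frame at \<sigma>, in general not the standard one, and frame independence
  compares the two.\<close>

lemma hodge_locus_transport:
  assumes \<tau>: "\<tau> \<in> Siegel" and iso: "clinear_iso a a'" and lat: "a ` Siegel_lattice d \<tau> = Siegel_lattice d \<sigma>"
    and form: "\<And>x y. siegel_form \<tau> x y = siegel_form \<sigma> (a x) (a y)"
    and \<sigma>: "\<sigma> \<in> hodge_locus d k"
  shows "\<tau> \<in> hodge_locus d k"
proof -
  obtain b where b: "bilinear b" "hodge b" "\<forall>x\<in>Siegel_lattice d \<sigma>. \<forall>y\<in>Siegel_lattice d \<sigma>. b x y \<in> \<int>"
      "\<nexists>q. \<forall>x y. b x y = q * siegel_form \<sigma> x y" "rosati_norm (siegel_e \<sigma>) (\<lambda>i. axis i 1) b \<le> k"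
      "\<sigma> \<in> Siegel"
    using \<sigma> unfolding hodge_locus_def by blast
  have a: "linear a" "\<And>c v. a (c *s v) = c *s a v" "\<And>v. a' (a v) = v" "\<And>w. a (a' w) = w"
    using iso by (auto simp: clinear_iso_def clinear_def)
  let ?b = "\<lambda>x y. b (a x) (a y)"
  have "bilinear ?b" by (rule bilinear_compose[OF b(1) a(1)])
  moreover have "hodge ?b" using b(2) by (simp add: hodge_def a(2))
  moreover have "\<forall>x\<in>Siegel_lattice d \<tau>. \<forall>y\<in>Siegel_lattice d \<tau>. ?b x y \<in> \<int>"
    using b(3) lat by blast
  moreover have "\<nexists>q. \<forall>x y. ?b x y = q * siegel_form \<tau> x y"
    using b(4) unfolding form by (metis a(4))
  moreover have "rosati_norm (siegel_e \<tau>) (\<lambda>i. axis i 1) ?b \<le> k"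
  proof -
    let ?e = "\<lambda>i. a (siegel_e \<tau> i)" and ?f = "\<lambda>i. a (axis i 1)"
    have "symplectic_frame (siegel_form \<sigma>) ?e ?f"
      unfolding symplectic_frame_def
    proof
      fix x
      have "a' x = (\<Sum>i\<in>UNIV. siegel_form \<tau> (a' x) (axis i 1) *\<^sub>R siegel_e \<tau> i - siegel_form \<tau> (a' x) (siegel_e \<tau> i) *\<^sub>R axis i 1)"
        using siegel_symplectic_frame[OF \<tau>] unfolding symplectic_frame_def by blast
      from arg_cong[OF this, of a]
      show "x = (\<Sum>i\<in>UNIV. siegel_form \<sigma> x (?f i) *\<^sub>R ?e i - siegel_form \<sigma> x (?e i) *\<^sub>R ?f i)"
        by (simp add: form a(4) linear_sum[OF a(1)] linear_diff[OF a(1)] linear_scale[OF a(1)])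
    qed
    from rosati_norm_frame_independent[OF b(1) bilinear_siegel_form siegel_form_swap this siegel_symplectic_frame[OF b(6)]]
    have "rosati_norm ?e ?f b \<le> k" using b(5) by simp
    then show ?thesis by (simp add: rosati_norm_explicit)
  qed
  ultimately show ?thesis unfolding hodge_locus_def using \<tau> by blast
qed

text \<open>Membership must not depend on the choice of period matrix. Uniqueness of the Riemann
  form shows that a preserves the forms when the second argument is in the lattice, hence everywhere
  since the lattice spans V; such an a transports the Hodge locus.\<close>

lemma moduli_hodge_locus_preimage:
  assumes d: "\<And>i. d i > 0"
  shows "{\<tau> \<in> Siegel. Siegel_AV d \<tau> \<in> moduli_locus d (hodge_locus d k)} = hodge_locus d k"
proof (intro Set.set_eqI iffI)
  fix \<tau> assume "\<tau> \<in> {\<tau> \<in> Siegel. Siegel_AV d \<tau> \<in> moduli_locus d (hodge_locus d k)}"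
  then obtain \<sigma> a b where \<tau>: "\<tau> \<in> Siegel" and \<sigma>: "\<sigma> \<in> hodge_locus d k" and iso: "clinear_iso a b"
    "a ` Siegel_lattice d \<tau> = Siegel_lattice d \<sigma>"
    "riemann_form (Siegel_lattice d \<tau>) (Siegel_bundle \<tau>) (\<lambda>x y. siegel_form \<sigma> (a x) (a y))"
    unfolding moduli_locus_def Siegel_AV_def by blast
  have lin: "linear a" using iso(1) by (simp add: clinear_iso_def clinear_def)
  note bi = bilinear_siegel_form[of \<tau>] bilinear_compose[OF bilinear_siegel_form[of \<sigma>] lin]
  have on_L: "siegel_form \<tau> x l = siegel_form \<sigma> (a x) (a l)" if "l \<in> Siegel_lattice d \<tau>" for x l
    by (rule riemann_form_unique[OF Siegel_lattice_cobounded[OF \<tau> d] bi riemann_form_Siegel[OF \<tau>] iso(3) that])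
  have "siegel_form \<tau> x y = siegel_form \<sigma> (a x) (a y)" for x y
  proof -
    obtain c where c: "y = (\<Sum>i\<in>UNIV. c i *\<^sub>R siegel_basis d \<tau> i)"
      using siegel_basis_expansion[of \<tau> d, OF \<tau> d] by blast
    show ?thesis
      unfolding c bilinear_sum_right[OF bi(1)] bilinear_sum_right[OF bi(2)]
        bilinear_rmul[OF bi(1)] bilinear_rmul[OF bi(2)]
      by (simp add: on_L siegel_basis_in_lattice)
  qed
  from hodge_locus_transport[OF \<tau> iso(1,2) this \<sigma>] show "\<tau> \<in> hodge_locus d k" .
next
  fix \<tau> assume "\<tau> \<in> hodge_locus d k"
  moreover have "hodge_locus d k \<subseteq> Siegel" by (auto simp: hodge_locus_def)
  ultimately show "\<tau> \<in> {\<tau> \<in> Siegel. Siegel_AV d \<tau> \<in> moduli_locus d (hodge_locus d k)}"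
    using Siegel_AV_in_moduli_locus by blast
qed

lemma smaller_sublocus_hodge_locus:
  assumes "\<And>i. d i > 0"
  shows "smaller_sublocus d (moduli_locus d (hodge_locus d k))"
  unfolding smaller_sublocus_def moduli_hodge_locus_preimage[of d, OF assms] Let_def
  by (intro conjI ballI impI moduli_locus_invariant hodge_locus_analytic hodge_locus_codense assms)

text \<open>In fact every polarised abelian variety of type \<open>d\<close> is isomorphic to some \<open>Siegel_AV d \<tau>\<close>, so this set
  contains none of them; the argument does not need this.\<close>

lemma smaller_sublocus_not_Siegel: "smaller_sublocus d (- moduli_locus d Siegel)"
proof -
  have empty: "{\<tau> \<in> Siegel. Siegel_AV d \<tau> \<in> - moduli_locus d Siegel} = {}"
    using Siegel_AV_in_moduli_locus[of _ Siegel d] by blast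
  have "analytic_subset ({} :: (complex^'n^'n) set)"
    unfolding analytic_subset_def holomorphic_wrt_def
    by (auto intro!: exI[of _ 1] exI[of _ "{\<lambda>_. 1}"] exI[of _ "\<lambda>_. 0"])
  moreover have "Siegel \<subseteq> closure (Siegel - {})"
    using closure_subset by simp
  ultimately show ?thesis
    unfolding smaller_sublocus_def Let_def empty unfolding Compl_iff
    by (intro conjI ballI impI arg_cong[of _ _ Not] moduli_locus_invariant)
qed

text \<open>The Riemann form is 1 on the lattice vectors e_i0 and f_i0, so q is an integer. Then e_i
  / d_i pairs integrally with the lattice under b, since its partner in the basis is d_i f_i.
  Unimodularity puts it into the lattice, against its coordinate 1 / d_i.\<close>

lemma unimodular_not_multiple:
  assumes \<tau>: "\<tau> \<in> Siegel" and d: "d i0 = 1" "d i \<noteq> 1" "d i > 0"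
    and uni: "\<And>x. x \<in> Siegel_lattice d \<tau> \<longleftrightarrow> (\<forall>l\<in>Siegel_lattice d \<tau>. b x l \<in> \<int>)"
    and b: "\<And>x y. b x y = q * siegel_form \<tau> x y"
  shows False
proof -
  have form: "siegel_form \<tau> (siegel_e \<tau> j) (siegel_basis d \<tau> c) = siegel_weight d c * standard_symplectic (Inl j) c" for j c
  proof -
    have "siegel_form \<tau> (siegel_frame \<tau> (Inl j)) (siegel_frame \<tau> c) = standard_symplectic (Inl j) c"
      using gram_siegel_form[OF \<tau>] by (simp add: gram_def fun_eq_iff)
    then show ?thesis
      by (simp add: siegel_basis_weight bilinear_rmul[OF bilinear_siegel_form] siegel_frame_def)
  qed
  have "siegel_e \<tau> i0 \<in> Siegel_lattice d \<tau>"
    using siegel_basis_in_lattice[of d \<tau> "Inl i0"] by (simp add: siegel_basis_def)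
  then have "b (siegel_e \<tau> i0) (siegel_basis d \<tau> (Inr i0)) \<in> \<int>"
    using uni siegel_basis_in_lattice by blast
  then have q: "q \<in> \<int>"
    by (simp add: b form siegel_weight_def standard_symplectic_def d(1))
  let ?x = "(1 / d i) *\<^sub>R siegel_e \<tau> i"
  have basis: "b ?x (siegel_basis d \<tau> c) \<in> \<int>" for c
    using q d(3) by (cases c) (auto simp: b bilinear_lmul[OF bilinear_siegel_form] form siegel_weight_def standard_symplectic_def)
  have "b ?x l \<in> \<int>" if l_in: "l \<in> Siegel_lattice d \<tau>" for l
  proof -
    obtain k :: "_ \<Rightarrow> int" where l: "l = (\<Sum>a\<in>UNIV. of_int (k a) *\<^sub>R siegel_basis d \<tau> a)"
      using l_in unfolding Siegel_lattice_eq by blast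
    have "b ?x l = (\<Sum>a\<in>UNIV. of_int (k a) * b ?x (siegel_basis d \<tau> a))"
      by (simp add: b l bilinear_sum_right[OF bilinear_siegel_form] bilinear_rmul[OF bilinear_siegel_form]
          sum_distrib_left mult_ac)
    then show ?thesis using basis by (auto intro!: Ints_sum Ints_mult)
  qed
  then have "?x \<in> Siegel_lattice d \<tau>" using uni by blast
  then have "siegel_p \<tau> ?x $ i \<in> \<int>" by (rule siegel_p_lattice[OF \<tau>])
  then have "1 / real (d i) \<in> \<int>"
    by (simp add: linear_scale[OF linear_siegel_p] siegel_p_e[OF \<tau>])
  then obtain m where "1 / real (d i) = real_of_int m" by (elim Ints_cases)
  then have "real_of_int (m * int (d i)) = 1" using d(3) by (simp add: field_simps)
  then have "m * int (d i) = 1" by linarith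
  then have "int (d i) dvd 1" by (metis dvd_triv_right)
  then show False using d(2,3) by simp
qed

theorem theorem4p6:
  fixes d :: "'n::{finite,linorder} \<Rightarrow> nat"
  assumes "\<And>i. d i > 0"
    and "d (Min UNIV) = 1"
    and "\<And>i j. i \<le> j \<Longrightarrow> d i dvd d j"
    and "d \<noteq> (\<lambda>i. 1)"
  shows "very_generally d (\<lambda>A. \<not> isomorphic_to_dual (fst A))"
  unfolding very_generally_def
proof (intro exI conjI ballI impI)
  \<comment> \<open>Every form has a trace below some integer k, so countably many loci catch all
    varieties with an extra form. The additional set supplies a period matrix \<tau> for each A
    outside the union.\<close>
  let ?Z = "insert (- moduli_locus d Siegel) (range (\<lambda>k. moduli_locus d (hodge_locus d k)))"
  show "countable ?Z" by simp
  show "smaller_sublocus d Z" if "Z \<in> ?Z" for Z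
    using that smaller_sublocus_not_Siegel smaller_sublocus_hodge_locus[of d, OF assms(1)] by auto
  fix A assume A: "A \<in> polarised_AVs d" "A \<notin> \<Union>?Z"
  obtain L e where Le: "A = (L, e)" by (cases A)
  show "\<not> isomorphic_to_dual (fst A)"
  proof
    assume dual: "isomorphic_to_dual (fst A)"
    have "(L, e) \<in> moduli_locus d Siegel" using A(2) Le by auto
    then obtain \<tau> a b where \<tau>: "\<tau> \<in> Siegel" and iso: "clinear_iso a b" "a ` L = Siegel_lattice d \<tau>"
      "riemann_form L e (\<lambda>x y. siegel_form \<tau> (a x) (a y))"
      unfolding moduli_locus_def by blast
    have ab: "\<And>v. b (a v) = v" "\<And>w. a (b w) = w" "linear b" "\<And>c v. b (c *s v) = c *s b v"
      using iso(1) by (auto simp: clinear_iso_def clinear_def)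
    have L: "lattice_in L" "isomorphic_to_dual L" using A(1) dual Le by (auto simp: polarised_AVs_def)
    obtain \<beta> where "bilinear \<beta> \<and> (\<forall>x y. \<beta> (\<i> *s x) (\<i> *s y) = \<beta> x y) \<and> (\<forall>x. x \<in> L \<longleftrightarrow> (\<forall>l\<in>L. (\<beta> x l :: real) \<in> \<int>))"
      using isomorphic_to_dual_imp_form[OF L] by (elim exE)
    then have \<beta>: "bilinear \<beta>" "\<beta> (\<i> *s x) (\<i> *s y) = \<beta> x y" "x \<in> L \<longleftrightarrow> (\<forall>l\<in>L. \<beta> x l \<in> \<int>)" for x y
      by blast+
    \<comment> \<open>The form given by the isomorphism to the dual, moved to the period coordinates
      of \<tau>.\<close>
    define \<gamma> where "\<gamma> x y = \<beta> (b x) (b y)" for x y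
    have mem: "x \<in> Siegel_lattice d \<tau> \<longleftrightarrow> b x \<in> L" for x
      using iso(2) ab(1,2) by (metis image_iff)
    have uni: "x \<in> Siegel_lattice d \<tau> \<longleftrightarrow> (\<forall>l\<in>Siegel_lattice d \<tau>. \<gamma> x l \<in> \<int>)" for x
    proof -
      have "(\<forall>l\<in>Siegel_lattice d \<tau>. \<gamma> x l \<in> \<int>) \<longleftrightarrow> (\<forall>l\<in>L. \<beta> (b x) l \<in> \<int>)"
        unfolding iso(2)[symmetric] \<gamma>_def by (simp add: ab(1))
      then show ?thesis unfolding mem \<beta>(3)[of "b x"] ..
    qed
    obtain i where i: "d i \<noteq> 1" using assms(4) by auto
    have "bilinear \<gamma>" unfolding \<gamma>_def by (rule bilinear_compose[OF \<beta>(1) ab(3)])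
    moreover have "hodge \<gamma>" by (simp add: hodge_def \<gamma>_def ab(4) \<beta>(2))
    moreover have "\<forall>x\<in>Siegel_lattice d \<tau>. \<forall>y\<in>Siegel_lattice d \<tau>. \<gamma> x y \<in> \<int>"
      using uni by blast
    moreover have "\<nexists>q. \<forall>x y. \<gamma> x y = q * siegel_form \<tau> x y"
      using unimodular_not_multiple[OF \<tau> assms(2) i assms(1) uni] by blast
    \<comment> \<open>Rounding the trace up selects the level k of the locus that contains
      \<tau>.\<close>
    moreover have "rosati_norm (siegel_e \<tau>) (\<lambda>i. axis i 1) \<gamma> \<le>
        nat \<lceil>rosati_norm (siegel_e \<tau>) (\<lambda>i. axis i 1) \<gamma>\<rceil>"
      by (rule real_nat_ceiling_ge)
    ultimately have "\<tau> \<in> hodge_locus d (nat \<lceil>rosati_norm (siegel_e \<tau>) (\<lambda>i. axis i 1) \<gamma>\<rceil>)"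
      unfolding hodge_locus_def using \<tau> by blast
    then have "A \<in> moduli_locus d (hodge_locus d (nat \<lceil>rosati_norm (siegel_e \<tau>) (\<lambda>i. axis i 1) \<gamma>\<rceil>))"
      unfolding moduli_locus_def Le using iso by blast
    then show False using A(2) by blast
  qed
qed

end
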